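(* Let $n\ge2$ be an even integer, $k=n/2$, $\beta>1$, and $w_1(x)=\left(\ln\frac{\mathrm{e}}{|x|}\right)^{\frac{\beta n}{2}}$ on the unit ball $B\subset\mathbb{R}^n$. Then the continuous embedding $\Phi^{k}_{0,\mathrm{rad}}(B,w_1)\hookrightarrow L^\infty(B)$ holds; that is, there is a constant $C>0$ such that $\|u\|_{L^\infty(B)}\le C\|u\|_{\Phi,w_1}$ for every $u\in\Phi^{k}_{0,\mathrm{rad}}(B,w_1)$.
   Context: $B$ is the open unit ball of $\mathbb{R}^n$ centered at $0$, $\omega_{n-1}$ is the area of the unit sphere in $\mathbb{R}^n$, and $c_n=\frac{\omega_{n-1}}{k}\binom{n-1}{k-1}$. For $u\in C^2(B)$, $S_j(D^2u)$ is the sum of all $j\times j$ principal minors of the Hessian matrix $D^2u$. A function $u\in C^2(B)\cap C^0(\overline{B})$ is $k$-admissible if $S_j(D^2u)\ge0$ in $B$ for $j=1,\dots,k$. $\Phi^k_{0,\mathrm{rad}}(B)$ is the set of radially symmetric $k$-admissible functions on $B$ vanishing on $\partial B$. For a positive radial weight $w(x)=w(r)$ and a radial function $u(x)=v(r)$, $r=|x|$, set $$\|u\|_{\Phi,w}=\Big(c_n\int_0^1 r^{n-k}|v'(r)|^{k+1}w(r)\,\mathrm{d}r\Big)^{\frac{1}{k+1}}.$$ $\Phi^k_{0,\mathrm{rad}}(B,w)$ is the closure, with respect to $\|\cdot\|_{\Phi,w}$, of $\{u\in\Phi^k_{0,\mathrm{rad}}(B):\|u\|_{\Phi,w}<\infty\}$;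 its elements are identified with radial functions $u(x)=v(|x|)$, $v$ locally absolutely continuous on $(0,1)$ with $v(r)\to0$ as $r\to1$, that are limits of sequences in this set in the sense that $\|u_m-u\|_{\Phi,w}\to0$ (norm given by the same formula). *)

theory Defs
  imports "HOL-Analysis.Analysis" "HOL-Probability.Essential_Supremum"
begin

definition partial :: "'n \<Rightarrow> (real^'n::finite \<Rightarrow> real) \<Rightarrow> real^'n \<Rightarrow> real" where
  "partial i u x = frechet_derivative u (at x) (axis i 1)"

definition hessian :: "(real^'n::finite \<Rightarrow> real) \<Rightarrow> real^'n \<Rightarrow> real^'n^'n" where
  "hessian u x = (\<chi> i j. partial i (partial j u) x)"

(* For open S only. Continuity of u and of its first partial derivatives on S follows from
   their differentiability. *)
definition C2_on :: "(real^'n::finite) set \<Rightarrow> (real^'n \<Rightarrow> real) \<Rightarrow> bool" where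
  "C2_on S u \<longleftrightarrow>
     u differentiable_on S \<and>
     (\<forall>i. partial i u differentiable_on S) \<and>
     (\<forall>i j. continuous_on S (partial i (partial j u)))"

(* The determinant of the submatrix of A with rows and columns in I, by the Leibniz formula
   that also defines det; a submatrix indexed by a varying set is not of a type real^'m^'m. *)
definition principal_minor :: "real^'n^'n::finite \<Rightarrow> 'n set \<Rightarrow> real" where
  "principal_minor A I = (\<Sum>p | p permutes I. of_int (sign p) * (\<Prod>i\<in>I. A $ i $ p i))"

lemma principal_minor_UNIV: "principal_minor A UNIV = det A"
  by (simp add: principal_minor_def det_def)

definition minor_sum :: "nat \<Rightarrow> real^'n^'n::finite \<Rightarrow> real" where
  "minor_sum j A = (\<Sum>I | card I = j. principal_minor A I)"

(* Functions on the unit ball B or its closure are represented by total functions; their values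
   elsewhere are never used. *)
definition k_admissible :: "nat \<Rightarrow> (real^'n::finite \<Rightarrow> real) \<Rightarrow> bool" where
  "k_admissible k u \<longleftrightarrow>
     C2_on (ball 0 1) u \<and> continuous_on (cball 0 1) u \<and>
     (\<forall>j\<in>{1..k}. \<forall>x\<in>ball 0 1. minor_sum j (hessian u x) \<ge> 0)"

definition radial_on :: "(real^'n::finite) set \<Rightarrow> (real^'n \<Rightarrow> real) \<Rightarrow> bool" where
  "radial_on S u \<longleftrightarrow> (\<forall>x\<in>S. \<forall>y\<in>S. norm x = norm y \<longrightarrow> u x = u y)"

(* The function v with u x = v (norm x), for radial u; the choice of the unit vector is then
   immaterial. *)
definition radial_profile :: "(real^'n::finite \<Rightarrow> real) \<Rightarrow> real \<Rightarrow> real" where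
  "radial_profile u r = u (r *\<^sub>R (SOME e. norm e = 1))"

lemma radial_profile_norm:
  fixes u :: "real^'n::finite \<Rightarrow> real"
  assumes "radial_on S u" "x \<in> S" "sphere 0 (norm x) \<subseteq> S"
  shows "radial_profile u (norm x) = u x"
proof -
  obtain e :: "real^'n" where "norm e = 1"
    using vector_choose_size[of 1] by auto
  then have "norm (SOME e::real^'n. norm e = 1) = 1"
    by (rule someI)
  then have n: "norm (norm x *\<^sub>R (SOME e::real^'n. norm e = 1)) = norm x"
    by simp
  with assms(3) have "norm x *\<^sub>R (SOME e::real^'n. norm e = 1) \<in> S"
    by auto
  with n assms(1,2) show ?thesis
    unfolding radial_on_def radial_profile_def by blast
qed

definition Phi0_rad :: "nat \<Rightarrow> (real^'n::finite \<Rightarrow> real) set" where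
  "Phi0_rad k = {u. k_admissible k u \<and> radial_on (cball 0 1) u \<and> (\<forall>x\<in>sphere 0 1. u x = 0)}"

(* Area of the unit sphere, by integration in polar coordinates: |B| = area / n. *)
definition unit_sphere_area :: "'n::finite itself \<Rightarrow> real" where
  "unit_sphere_area _ = real CARD('n) * measure lborel (ball (0::real^'n) 1)"

definition c_const :: "'n::finite itself \<Rightarrow> nat \<Rightarrow> real" where
  "c_const N k = unit_sphere_area N / real k * real ((CARD('n) - 1) choose (k - 1))"

definition Phi_energy ::
    "nat \<Rightarrow> (real^'n::finite \<Rightarrow> real) \<Rightarrow> (real^'n \<Rightarrow> real) \<Rightarrow> ennreal" where
  "Phi_energy k w u = ennreal (c_const TYPE('n) k) *
     (\<integral>\<^sup>+ r\<in>{0<..<1}. ennreal (r ^ (CARD('n) - k) * \<bar>deriv (radial_profile u) r\<bar> ^ (k + 1)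
        * radial_profile w r) \<partial>lebesgue)"

(* The norm with weight w, with value \<infinity> where the integral diverges. *)
definition Phi_norm ::
    "nat \<Rightarrow> (real^'n::finite \<Rightarrow> real) \<Rightarrow> (real^'n \<Rightarrow> real) \<Rightarrow> ennreal" where
  "Phi_norm k w u =
     (if Phi_energy k w u = \<infinity> then \<infinity>
      else ennreal (enn2real (Phi_energy k w u) powr (1 / real (k + 1))))"

definition absolutely_continuous_fun_on :: "real set \<Rightarrow> (real \<Rightarrow> real) \<Rightarrow> bool" where
  "absolutely_continuous_fun_on S f \<longleftrightarrow>
     (\<forall>\<epsilon>>0. \<exists>\<delta>>0. \<forall>D T. D division_of T \<and> T \<subseteq> S \<and> (\<Sum>K\<in>D. Sup K - Inf K) < \<delta> \<longrightarrow>
        (\<Sum>K\<in>D. \<bar>f (Sup K) - f (Inf K)\<bar>) < \<epsilon>)"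

definition locally_absolutely_continuous :: "(real \<Rightarrow> real) \<Rightarrow> bool" where
  "locally_absolutely_continuous f \<longleftrightarrow>
     (\<forall>a b. 0 < a \<and> a < b \<and> b < 1 \<longrightarrow> absolutely_continuous_fun_on {a..b} f)"

definition Phi0_rad_weighted ::
    "nat \<Rightarrow> (real^'n::finite \<Rightarrow> real) \<Rightarrow> (real^'n \<Rightarrow> real) set" where
  "Phi0_rad_weighted k w = {u.
     radial_on (ball 0 1) u \<and>
     locally_absolutely_continuous (radial_profile u) \<and>
     (radial_profile u \<longlongrightarrow> 0) (at_left 1) \<and>
     (\<exists>U. (\<forall>m. U m \<in> Phi0_rad k \<and> Phi_norm k w (U m) < \<infinity>) \<and>
          (\<lambda>m. Phi_norm k w (\<lambda>x. U m x - u x)) \<longlonglongrightarrow> 0)}"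

definition w1 :: "real \<Rightarrow> real^'n::finite \<Rightarrow> real" where
  "w1 \<beta> x = ln (exp 1 / norm x) powr (\<beta> * real CARD('n) / 2)"

(* As for any esssup, the value is \<infinity> if u is not measurable on the ball. *)
definition Linf_norm :: "(real^'n::finite \<Rightarrow> real) \<Rightarrow> ennreal" where
  "Linf_norm u = esssup (lebesgue_on (ball 0 1)) (\<lambda>x. ennreal \<bar>u x\<bar>)"

end

(* Since n = 2k, Hoelder's inequality with exponents k + 1 and (k + 1) / k gives, for a radial
   function with profile v vanishing at 1 and L(s) = ln (e / s),
     |v(r)| <= int_r^1 |v'| ds
            <= (int_0^1 s^k |v'|^(k+1) L^(beta k) ds)^(1/(k+1)) (int_0^1 ds / (s L^beta))^(k/(k+1)),
   and the last integral is 1 / (beta - 1), finite because beta > 1. The first inequality is the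
   fundamental theorem of calculus for absolutely continuous functions. It rests on the
   differentiability almost everywhere of functions of bounded variation, which follows from the
   Vitali covering theorem, and on a gauge in which the exceptional null set is covered by an open
   set of small measure. *)
theory Submission
  imports Defs
begin

section \<open>Differentiability almost everywhere of functions of bounded variation\<close>

text \<open>The energy is built from \<open>deriv\<close>, whose value is arbitrary where a profile
  is not differentiable. An element of the closure has a profile that is only locally absolutely
  continuous, so its energy controls the profile only once differentiability almost everywhere is
  known. The same fact lets \<open>deriv\<close> pass through differences up to a null set.

  The triangle inequality for the norm is avoided. For finite norm the pointwise estimate applies to
  u itself, and for infinite norm the inequality is trivial. Boundedness of u comes from applying
  the same estimate to the difference of u and one admissible function.

  The resulting constant is 1 + 1 / (\<beta> - 1) times the (k + 1)-th root of 1 / c_n. It differs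
  from the Hoelder constant because the integrand is split pointwise into two summands, and each of
  them contributes one term of the sum.\<close>

lemma emeasure_disjoint_images_le:
  fixes h :: "real \<Rightarrow> real"
  assumes C: "countable C"
    and mono: "mono_on {c..d} h" and "c \<le> d"
    and ord: "\<And>i. i \<in> C \<Longrightarrow> c \<le> fst i \<and> fst i < snd i \<and> snd i \<le> d"
    and disj: "disjoint_family_on (\<lambda>i. {fst i..snd i}) C"
  shows "(\<integral>\<^sup>+i. ennreal (h (snd i) - h (fst i)) \<partial>count_space C) \<le> ennreal (h d - h c)"
proof -
  have hm: "h x \<le> h y" if "c \<le> x" "x \<le> y" "y \<le> d" for x y
    using mono that by (auto simp: mono_on_def)
  \<comment> \<open>The images are taken as open intervals: if \<open>h\<close> is constant between
    two of the given intervals, the closed images share an endpoint.\<close>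
  have dj: "disjoint_family_on (\<lambda>i. {h (fst i)<..<h (snd i)}) C"
  proof (unfold disjoint_family_on_def, intro ballI impI)
    fix i j assume ij: "i \<in> C" "j \<in> C" "i \<noteq> j"
    then have "{fst i..snd i} \<inter> {fst j..snd j} = {}"
      using disj by (auto simp: disjoint_family_on_def)
    then have "snd i < fst j \<or> snd j < fst i"
      using ord[OF ij(1)] ord[OF ij(2)]
      by (metis Int_iff atLeastAtMost_iff empty_iff less_imp_le linorder_not_le linorder_linear)
    then have "h (snd i) \<le> h (fst j) \<or> h (snd j) \<le> h (fst i)"
      using ord[OF ij(1)] ord[OF ij(2)] hm by (metis less_imp_le order_trans)
    then show "{h (fst i)<..<h (snd i)} \<inter> {h (fst j)<..<h (snd j)} = {}"
      by auto
  qed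
  have "(\<integral>\<^sup>+i. ennreal (h (snd i) - h (fst i)) \<partial>count_space C)
      = (\<integral>\<^sup>+i. emeasure lborel {h (fst i)<..<h (snd i)} \<partial>count_space C)"
  proof (rule nn_integral_cong)
    fix i assume "i \<in> space (count_space C)"
    then show "ennreal (h (snd i) - h (fst i)) = emeasure lborel {h (fst i)<..<h (snd i)}"
      using ord[of i] by (subst emeasure_lborel_Ioo) (auto intro!: hm)
  qed
  also have "\<dots> = emeasure lborel (\<Union>i\<in>C. {h (fst i)<..<h (snd i)})"
    by (rule emeasure_UN_countable[symmetric]) (use C dj in auto)
  also have "\<dots> \<le> emeasure lborel {h c..h d}"
  proof (rule emeasure_mono)
    have "h (snd i) \<le> h d" "h c \<le> h (fst i)" if "i \<in> C" for i
      using ord[OF that] by (auto intro: hm)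
    then show "(\<Union>i\<in>C. {h (fst i)<..<h (snd i)}) \<subseteq> {h c..h d}"
      by force
  qed auto
  also have "\<dots> = ennreal (h d - h c)"
    using hm[of c d] \<open>c \<le> d\<close> by simp
  finally show ?thesis .
qed

text \<open>The short intervals on which \<open>h\<close> grows at rate at least \<alpha> form a
  Vitali cover of \<open>S\<close>. A disjoint countable subfamily covers \<open>S\<close> up to a
  null set, and its total length is at most 1 / \<alpha> times the growth of \<open>h\<close> over
  its members. The set \<open>T\<close> expresses a bound on outer measure, as \<open>S\<close> may
  be nonmeasurable.\<close>

lemma mono_steep_set_measure_le:
  fixes h :: "real \<Rightarrow> real"
  assumes mono: "mono_on {c..d} h" and cd: "c \<le> d" and \<alpha>: "\<alpha> > 0"
    and S: "\<And>x. x \<in> S \<Longrightarrow> x \<in> {c<..<d} \<and> (\<exists>\<^sub>F y in at x. \<alpha> * \<bar>y - x\<bar> \<le> \<bar>h y - h x\<bar>)"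
  shows "\<exists>T. S \<subseteq> T \<and> T \<in> lmeasurable \<and> measure lebesgue T \<le> (h d - h c) / \<alpha>"
proof -
  \<comment> \<open>Intervals are coded by their endpoints. The covering theorem speaks of closed
    balls, which on the line are intervals with midpoint \<open>?a\<close> and half-length
    \<open>?r\<close>.\<close>
  define K where "K = {i. c \<le> fst i \<and> fst i < snd i \<and> snd i \<le> d \<and>
      \<alpha> * (snd i - fst i) \<le> h (snd i) - h (fst i)}"
  let ?a = "\<lambda>i::real\<times>real. (fst i + snd i) / 2"
  let ?r = "\<lambda>i::real\<times>real. (snd i - fst i) / 2"
  have cb: "cball (?a i) (?r i) = {fst i..snd i}" for i
    by (auto simp: cball_eq_atLeastAtMost field_simps)
  have hm: "h x \<le> h y" if "c \<le> x" "x \<le> y" "y \<le> d" for x y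
    using mono that by (auto simp: mono_on_def)
  obtain C where C: "countable C" "C \<subseteq> K"
    "pairwise (\<lambda>i j. disjnt (cball (?a i) (?r i)) (cball (?a j) (?r j))) C"
    "negligible (S - (\<Union>i\<in>C. cball (?a i) (?r i)))"
  proof (rule Vitali_covering_theorem_cballs[of K ?r S ?a])
    fix x e :: real assume x: "x \<in> S" and e: "0 < e"
    define r where "r = Min {e, x - c, d - x}"
    have r: "r > 0" "r \<le> e" "r \<le> x - c" "r \<le> d - x"
      using S[OF x] e by (auto simp: r_def)
    have "\<exists>\<^sub>F y in at x. (\<alpha> * \<bar>y - x\<bar> \<le> \<bar>h y - h x\<bar>) \<and> (dist y x < r \<and> y \<noteq> x)"
    proof (rule frequently_rev_mp[OF conjunct2[OF S[OF x]]])
      show "\<forall>\<^sub>F y in at x. \<alpha> * \<bar>y - x\<bar> \<le> \<bar>h y - h x\<bar> \<longrightarrow>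
          \<alpha> * \<bar>y - x\<bar> \<le> \<bar>h y - h x\<bar> \<and> dist y x < r \<and> y \<noteq> x"
        unfolding eventually_at using r(1) by auto
    qed
    then obtain y where y: "\<alpha> * \<bar>y - x\<bar> \<le> \<bar>h y - h x\<bar>" "\<bar>y - x\<bar> < r" "y \<noteq> x"
      by (auto dest!: frequently_ex simp: dist_real_def)
    have "(min x y, max x y) \<in> K"
      using y r hm[of x y] hm[of y x] by (auto simp: K_def min_def max_def)
    moreover have "x \<in> cball (?a (min x y, max x y)) (?r (min x y, max x y))"
      unfolding cb by auto
    moreover have "?r (min x y, max x y) < e"
      using y r by (auto simp: min_def max_def)
    ultimately show "\<exists>i. i \<in> K \<and> x \<in> cball (?a i) (?r i) \<and> ?r i < e"
      by blast
  qed (auto simp: K_def)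
  let ?U = "\<Union>i\<in>C. {fst i..snd i}"
  have Kd: "c \<le> fst i \<and> fst i < snd i \<and> snd i \<le> d"
    "snd i - fst i \<le> (h (snd i) - h (fst i)) / \<alpha>" if "i \<in> C" for i
    using C(2) that \<alpha> by (auto simp: K_def field_simps)
  have disj: "disjoint_family_on (\<lambda>i. {fst i..snd i}) C"
    using C(3) unfolding disjoint_family_on_def pairwise_def cb disjnt_def by blast
  have Us: "?U \<in> sets borel"
    using C(1) by (intro sets.countable_UN') auto
  have "emeasure lborel ?U = (\<integral>\<^sup>+i. emeasure lborel {fst i..snd i} \<partial>count_space C)"
    by (rule emeasure_UN_countable) (use C disj in auto)
  also have "\<dots> \<le> (\<integral>\<^sup>+i. ennreal (h (snd i) / \<alpha> - h (fst i) / \<alpha>) \<partial>count_space C)"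
    using Kd by (intro nn_integral_mono) (auto simp: less_imp_le ennreal_leI diff_divide_distrib)
  also have "\<dots> \<le> ennreal (h d / \<alpha> - h c / \<alpha>)"
    by (rule emeasure_disjoint_images_le[where h = "\<lambda>x. h x / \<alpha>"])
       (use C Kd disj cd \<alpha> hm in \<open>auto simp: mono_on_def divide_right_mono\<close>)
  finally have em: "emeasure lborel ?U \<le> ennreal ((h d - h c) / \<alpha>)"
    by (simp add: diff_divide_distrib)
  then have el: "emeasure lebesgue ?U \<le> ennreal ((h d - h c) / \<alpha>)"
    using Us by (simp add: emeasure_completion)
  have Ul: "?U \<in> lmeasurable"
    using Us el by (intro fmeasurableI) (auto intro: le_less_trans)
  have N: "negligible (S - ?U)" using C(4) unfolding cb .
  have "measure lebesgue (?U \<union> (S - ?U)) = measure lebesgue ?U"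
    using Ul N by (intro measure_negligible_symdiff) (auto intro: negligible_subset)
  also have "\<dots> \<le> (h d - h c) / \<alpha>"
    using el hm[of c d] cd \<alpha> unfolding measure_def
    by (intro enn2real_leI) auto
  finally have "measure lebesgue (?U \<union> (S - ?U)) \<le> (h d - h c) / \<alpha>" .
  moreover have "?U \<union> (S - ?U) \<in> lmeasurable"
    by (rule fmeasurable.Un[OF Ul negligible_imp_measurable[OF N]])
  moreover have "S \<subseteq> ?U \<union> (S - ?U)" by blast
  ultimately show ?thesis by (intro exI conjI)
qed

section \<open>Bounded variation and the slopes of a function\<close>

text \<open>Points of a sequence may repeat, so a sequence can be extended by endpoints without
  checking that they are new.\<close>

definition variation_bounded :: "(real \<Rightarrow> real) \<Rightarrow> real set \<Rightarrow> real \<Rightarrow> bool" where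
  "variation_bounded f S M \<longleftrightarrow> (\<forall>n t. (\<forall>i<n. t i \<le> t (Suc i)) \<and> (\<forall>i\<le>n. t i \<in> S) \<longrightarrow>
     (\<Sum>i<n. \<bar>f (t (Suc i)) - f (t i)\<bar>) \<le> M)"

lemma variation_boundedD:
  "variation_bounded f S M \<Longrightarrow> (\<And>i. i < n \<Longrightarrow> t i \<le> t (Suc i)) \<Longrightarrow> (\<And>i. i \<le> n \<Longrightarrow> t i \<in> S) \<Longrightarrow>
    (\<Sum>i<n. \<bar>f (t (Suc i)) - f (t i)\<bar>) \<le> M"
  unfolding variation_bounded_def by simp

lemma variation_bounded_diff_linear:
  assumes "variation_bounded f {c..d} M"
  shows "variation_bounded (\<lambda>x. f x - m * x) {c..d} (M + \<bar>m\<bar> * (d - c))"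
  unfolding variation_bounded_def
proof (intro allI impI)
  fix n and t :: "nat \<Rightarrow> real"
  assume t: "(\<forall>i<n. t i \<le> t (Suc i)) \<and> (\<forall>i\<le>n. t i \<in> {c..d})"
  have "(\<Sum>i<n. \<bar>f (t (Suc i)) - m * t (Suc i) - (f (t i) - m * t i)\<bar>)
     \<le> (\<Sum>i<n. \<bar>f (t (Suc i)) - f (t i)\<bar> + \<bar>m\<bar> * (t (Suc i) - t i))"
  proof (rule sum_mono)
    fix i assume "i \<in> {..<n}"
    then have "\<bar>m * (t (Suc i) - t i)\<bar> = \<bar>m\<bar> * (t (Suc i) - t i)"
      using t by (auto simp: abs_mult)
    then show "\<bar>f (t (Suc i)) - m * t (Suc i) - (f (t i) - m * t i)\<bar>
      \<le> \<bar>f (t (Suc i)) - f (t i)\<bar> + \<bar>m\<bar> * (t (Suc i) - t i)"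
      by (simp add: algebra_simps)
  qed
  also have "\<dots> = (\<Sum>i<n. \<bar>f (t (Suc i)) - f (t i)\<bar>) + \<bar>m\<bar> * (t n - t 0)"
    by (simp add: sum.distrib sum_distrib_left[symmetric] sum_lessThan_telescope)
  also have "\<dots> \<le> M + \<bar>m\<bar> * (d - c)"
    using t by (intro add_mono variation_boundedD[OF assms] mult_left_mono diff_mono) auto
  finally show "(\<Sum>i<n. \<bar>f (t (Suc i)) - m * t (Suc i) - (f (t i) - m * t i)\<bar>)
     \<le> M + \<bar>m\<bar> * (d - c)" .
qed

text \<open>The witness is the total variation of \<open>f\<close> on [c, x] as a function of x. The
  second property is the approximation of a supremum, with the points completed to a subdivision of
  all of [c, d].\<close>

lemma variation_function_exists:
  assumes bv: "variation_bounded f {c..d} M" and cd: "c \<le> d"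
  obtains V where "\<And>x y. c \<le> x \<Longrightarrow> x \<le> y \<Longrightarrow> y \<le> d \<Longrightarrow> \<bar>f y - f x\<bar> \<le> V y - V x"
    and "\<And>e. e > 0 \<Longrightarrow> \<exists>n t. mono t \<and> t 0 = c \<and> t n = d \<and>
           V d - V c - e < (\<Sum>i<n. \<bar>f (t (Suc i)) - f (t i)\<bar>)"
proof -
  define P where "P x = {(\<Sum>i<n. \<bar>f (t (Suc i)) - f (t i)\<bar>) | n t.
      (\<forall>i<n. t i \<le> t (Suc i)) \<and> (\<forall>i\<le>n. t i \<in> {c..x})}" for x
  define V where "V x = Sup (P x)" for x
  have ne: "P x \<noteq> {}" if "c \<le> x" for x
    unfolding P_def using that by (auto intro!: exI[of _ "0::nat"] exI[of _ "\<lambda>_. c"])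
  have bd: "bdd_above (P x)" if "x \<le> d" for x
    unfolding P_def bdd_above_def using that
    by (auto intro!: exI[of _ M] variation_boundedD[OF bv])
  have step: "V x + \<bar>f y - f x\<bar> \<le> V y" if xy: "c \<le> x" "x \<le> y" "y \<le> d" for x y
  proof -
    have "s \<le> V y - \<bar>f y - f x\<bar>" if "s \<in> P x" for s
    proof -
      from that obtain n t where t: "\<forall>i<n. t i \<le> t (Suc i)" "\<forall>i\<le>n. t i \<in> {c..x}"
        and s: "s = (\<Sum>i<n. \<bar>f (t (Suc i)) - f (t i)\<bar>)"
        unfolding P_def by blast
      \<comment> \<open>Appending \<open>x\<close> and \<open>y\<close> adds the increment from
        \<open>x\<close> to \<open>y\<close>, besides a nonnegative term from \<open>t n\<close> to
        \<open>x\<close>.\<close>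
      define t' where "t' i = (if i \<le> n then t i else if i = Suc n then x else y)" for i
      have "s + \<bar>f y - f x\<bar> \<le> (\<Sum>i<Suc (Suc n). \<bar>f (t' (Suc i)) - f (t' i)\<bar>)"
      proof -
        have "(\<Sum>i<n. \<bar>f (t' (Suc i)) - f (t' i)\<bar>) = s"
          unfolding s by (intro sum.cong) (auto simp: t'_def)
        then show ?thesis by (simp add: t'_def)
      qed
      also have "\<dots> \<le> V y"
        unfolding V_def
      proof (rule cSup_upper[OF _ bd[OF xy(3)]])
        have "(\<forall>i<Suc (Suc n). t' i \<le> t' (Suc i)) \<and> (\<forall>i\<le>Suc (Suc n). t' i \<in> {c..y})"
          using t xy unfolding t'_def by (auto simp: less_Suc_eq intro: order_trans)
        then show "(\<Sum>i<Suc (Suc n). \<bar>f (t' (Suc i)) - f (t' i)\<bar>) \<in> P y"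
          unfolding P_def by blast
      qed
      finally show ?thesis by simp
    qed
    then have "V x \<le> V y - \<bar>f y - f x\<bar>"
      unfolding V_def[of x] using ne xy by (intro cSup_least) auto
    then show ?thesis by simp
  qed
  have Vc: "V c \<ge> 0"
    unfolding V_def using cd
    by (intro cSup_upper bd) (auto simp: P_def intro!: exI[of _ "0::nat"] exI[of _ "\<lambda>_. c"])
  show thesis
  proof (rule that[of V])
    fix e :: real assume e: "e > 0"
    then have "V d - V c - e < Sup (P d)" using Vc by (simp add: V_def[of d])
    then obtain s where "s \<in> P d" "V d - V c - e < s"
      using less_cSupD[OF ne] cd by blast
    then obtain n t where t: "\<forall>i<n. t i \<le> t (Suc i)" "\<forall>i\<le>n. t i \<in> {c..d}"
        and s: "V d - V c - e < (\<Sum>i<n. \<bar>f (t (Suc i)) - f (t i)\<bar>)"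
      unfolding P_def by blast
    \<comment> \<open>The shift by one makes room for \<open>c\<close> in front. From index
      \<open>Suc (Suc n)\<close> on the sequence stays at \<open>d\<close>, which makes it monotone
      on all naturals.\<close>
    define t' where "t' i = (if i = 0 then c else if i \<le> Suc n then t (i - 1) else d)" for i
    have "(\<Sum>i<n. \<bar>f (t (Suc i)) - f (t i)\<bar>) = (\<Sum>i<n. \<bar>f (t' (Suc (Suc i))) - f (t' (Suc i))\<bar>)"
      by (intro sum.cong) (auto simp: t'_def)
    also have "\<dots> \<le> (\<Sum>i<Suc (Suc n). \<bar>f (t' (Suc i)) - f (t' i)\<bar>)"
      by (subst sum.lessThan_Suc_shift) simp
    finally have "V d - V c - e < (\<Sum>i<Suc (Suc n). \<bar>f (t' (Suc i)) - f (t' i)\<bar>)"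
      using s by simp
    moreover have "mono t'"
    proof (rule incseq_SucI)
      fix i
      show "t' i \<le> t' (Suc i)"
      proof (cases i)
        case 0
        then show ?thesis using t by (auto simp: t'_def)
      next
        case (Suc j)
        consider "j < n" | "j = n" | "j > n" by linarith
        then show ?thesis using t Suc by cases (auto simp: t'_def)
      qed
    qed
    ultimately show "\<exists>n t. mono t \<and> t 0 = c \<and> t n = d \<and>
           V d - V c - e < (\<Sum>i<n. \<bar>f (t (Suc i)) - f (t i)\<bar>)"
      by (intro exI[of _ "Suc (Suc n)"] exI[of _ t']) (simp add: t'_def)
  qed (use step in \<open>simp add: algebra_simps\<close>)
qed

lemma between_sequence_values:
  fixes t :: "nat \<Rightarrow> real"
  shows "t 0 < x \<Longrightarrow> x \<le> t n \<Longrightarrow> \<exists>i<n. t i < x \<and> x \<le> t (Suc i)"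
proof (induction n)
  case (Suc n)
  then show ?case
    by (cases "x \<le> t n") (auto simp: less_Suc_eq)
qed auto

text \<open>Austin's argument: take a subdivision whose variation sum is within \<open>\<alpha> * e\<close> of the total
  variation \<open>V d - V c\<close>. On each of its intervals, with \<open>s\<close> the sign of the increment of \<open>f\<close>, the
  function \<open>V - s * f\<close> is increasing, and at a point with slopes of both signs it is steep; as its
  increments sum up to at most \<open>\<alpha> * e\<close>, the Vitali covering theorem bounds the measure of the set
  of such points by \<open>e\<close>.\<close>

lemma negligible_opposite_slopes:
  assumes bv: "variation_bounded f {c..d} M" and cd: "c \<le> d" and \<alpha>: "\<alpha> > 0"
  shows "negligible {x\<in>{c<..<d}. (\<exists>\<^sub>F y in at x. (f y - f x) / (y - x) \<le> - \<alpha>) \<and>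
            (\<exists>\<^sub>F y in at x. (f y - f x) / (y - x) \<ge> \<alpha>)}" (is "negligible ?E")
proof -
  obtain V where V: "\<And>x y. c \<le> x \<Longrightarrow> x \<le> y \<Longrightarrow> y \<le> d \<Longrightarrow> \<bar>f y - f x\<bar> \<le> V y - V x"
    and near: "\<And>e. e > 0 \<Longrightarrow> \<exists>n t. mono t \<and> t 0 = c \<and> t n = d \<and>
           V d - V c - e < (\<Sum>i<n. \<bar>f (t (Suc i)) - f (t i)\<bar>)"
    by (rule variation_function_exists[OF bv cd]) blast
  show ?thesis
    unfolding negligible_outer_le
  proof (intro allI impI)
    fix e :: real assume e: "e > 0"
    obtain n t where t: "mono t" "t 0 = c" "t n = d"
      and nt: "V d - V c - \<alpha> * e < (\<Sum>i<n. \<bar>f (t (Suc i)) - f (t i)\<bar>)"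
      using near[of "\<alpha> * e"] e \<alpha> by auto
    have tcd: "c \<le> t i" "t i \<le> d" if "i \<le> n" for i
      using t monoD[OF t(1), of 0 i] monoD[OF t(1), of i n] that by auto
    define Q where "Q i T \<longleftrightarrow> ?E \<inter> {t i<..<t (Suc i)} \<subseteq> T \<and> T \<in> lmeasurable \<and>
      measure lebesgue T \<le> (V (t (Suc i)) - V (t i) - \<bar>f (t (Suc i)) - f (t i)\<bar>) / \<alpha>" for i T
    have "\<exists>T. Q i T" if i: "i < n" for i
    proof -
      define s :: real where "s = (if f (t i) \<le> f (t (Suc i)) then 1 else -1)"
      have s: "\<bar>s\<bar> = 1" "s * (f (t (Suc i)) - f (t i)) = \<bar>f (t (Suc i)) - f (t i)\<bar>"
        by (auto simp: s_def)
      have ti: "c \<le> t i" "t i \<le> t (Suc i)" "t (Suc i) \<le> d"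
        using tcd i t(1) by (auto simp: mono_def)
      define h where "h x = V x - s * f x" for x
      have hV: "V y - V x - s * (f y - f x) = h y - h x" for x y
        by (simp add: h_def algebra_simps)
      have sf: "s * (f y - f x) \<le> \<bar>f y - f x\<bar>" for x y
        using s(1) abs_ge_self[of "s * (f y - f x)"] by (simp add: abs_mult)
      have mono: "mono_on {t i..t (Suc i)} h"
        unfolding mono_on_def
      proof (intro allI impI)
        fix x y assume "x \<in> {t i..t (Suc i)} \<and> y \<in> {t i..t (Suc i)} \<and> x \<le> y"
        then show "h x \<le> h y"
          using V[of x y] sf[of y x] hV[of y x] ti by auto
      qed
      have "\<exists>\<^sub>F y in at x. \<alpha> * \<bar>y - x\<bar> \<le> \<bar>h y - h x\<bar>"
        if x: "x \<in> ?E" "x \<in> {t i<..<t (Suc i)}" for x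
      proof -
        \<comment> \<open>Of the two slope conditions the one with sign opposite to \<open>s\<close>
          is kept: there \<open>- s * f\<close> alone gains \<alpha> per unit length, and
          \<open>V\<close> does not decrease.\<close>
        have fr: "\<exists>\<^sub>F y in at x. s * ((f y - f x) / (y - x)) \<le> - \<alpha>"
        proof (cases "f (t i) \<le> f (t (Suc i))")
          case True
          then show ?thesis using x(1) by (simp add: s_def)
        next
          case False
          have "\<exists>\<^sub>F y in at x. \<alpha> \<le> (f y - f x) / (y - x)" using x(1) by simp
          then show ?thesis
            by (rule frequently_elim1) (use False in \<open>simp only: s_def if_False mult_minus_left mult_1 neg_le_iff_le\<close>)
        qed
        have "\<forall>\<^sub>F y in at x. y \<in> {t i<..<t (Suc i)}"
          using x(2) by (intro eventually_at_in_open' open_greaterThanLessThan)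
        moreover have "\<forall>\<^sub>F y in at x. y \<noteq> x"
          by (simp add: eventually_at_filter)
        ultimately have ev: "\<forall>\<^sub>F y in at x. y \<in> {t i<..<t (Suc i)} \<and> y \<noteq> x"
          by (rule eventually_conj)
        show ?thesis
        proof (rule frequently_rev_mp[OF fr], rule eventually_mono[OF ev], rule impI)
          fix y assume y: "y \<in> {t i<..<t (Suc i)} \<and> y \<noteq> x"
            and le: "s * ((f y - f x) / (y - x)) \<le> - \<alpha>"
          show "\<alpha> * \<bar>y - x\<bar> \<le> \<bar>h y - h x\<bar>"
          proof (cases "x < y")
            case True
            then have "s * ((f y - f x) / (y - x)) * (y - x) \<le> - \<alpha> * (y - x)"
              by (intro mult_right_mono[OF le]) simp
            then have "\<alpha> * (y - x) \<le> - (s * (f y - f x))"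
              using True by simp
            moreover have "0 \<le> V y - V x"
              using V[of x y] True x(2) y ti by auto
            ultimately have "\<alpha> * (y - x) \<le> h y - h x"
              using hV[of y x] by linarith
            then show ?thesis using True by simp
          next
            case False
            then have "y < x" using y by auto
            then have "s * ((f y - f x) / (y - x)) * (x - y) \<le> - \<alpha> * (x - y)"
              by (intro mult_right_mono[OF le]) simp
            moreover have "s * ((f y - f x) / (y - x)) * (x - y) = s * (f x - f y)"
              using \<open>y < x\<close> by (simp add: divide_simps) (simp add: algebra_simps)
            ultimately have "\<alpha> * (x - y) \<le> - (s * (f x - f y))"
              by simp
            moreover have "0 \<le> V x - V y"
              using V[of y x] \<open>y < x\<close> x(2) y ti by auto
            ultimately have "\<alpha> * (x - y) \<le> h x - h y"
              using hV[of x y] by linarith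
            then show ?thesis using \<open>y < x\<close> by simp
          qed
        qed
      qed
      then have "\<exists>T. ?E \<inter> {t i<..<t (Suc i)} \<subseteq> T \<and> T \<in> lmeasurable \<and>
          measure lebesgue T \<le> (h (t (Suc i)) - h (t i)) / \<alpha>"
        by (intro mono_steep_set_measure_le[OF mono ti(2) \<alpha>]) blast
      then show ?thesis
        using hV[of "t (Suc i)" "t i"] s(2) unfolding Q_def by simp
    qed
    then obtain T where QT: "\<And>i. i < n \<Longrightarrow> Q i (T i)"
      by metis
    have T: "?E \<inter> {t i<..<t (Suc i)} \<subseteq> T i"
      "T i \<in> lmeasurable"
      "measure lebesgue (T i) \<le>
         (V (t (Suc i)) - V (t i) - \<bar>f (t (Suc i)) - f (t i)\<bar>) / \<alpha>"
      if "i < n" for i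
      using QT[OF that] unfolding Q_def by blast+
    \<comment> \<open>The open subintervals miss the subdivision points, which form a finite and
      hence null set.\<close>
    let ?U = "(\<Union>i<n. T i) \<union> t ` {..n}"
    have fin: "negligible (t ` {..n})"
      by (simp add: negligible_finite)
    have Um: "(\<Union>i<n. T i) \<in> lmeasurable"
      using T(2) by (intro fmeasurable.finite_UN) auto
    have "measure lebesgue ?U = measure lebesgue (\<Union>i<n. T i)"
      using Um fin by (intro measure_negligible_symdiff) (auto intro: negligible_subset)
    also have "\<dots> \<le> (\<Sum>i<n. measure lebesgue (T i))"
      using T(2) by (intro measure_UNION_le) auto
    also have "\<dots> \<le> (\<Sum>i<n. (V (t (Suc i)) - V (t i) - \<bar>f (t (Suc i)) - f (t i)\<bar>) / \<alpha>)"
      using T(3) by (intro sum_mono) auto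
    also have "\<dots> = (V d - V c - (\<Sum>i<n. \<bar>f (t (Suc i)) - f (t i)\<bar>)) / \<alpha>"
      using t sum_lessThan_telescope[of "\<lambda>i. V (t i)" n]
      by (simp add: sum_divide_distrib[symmetric] sum_subtractf)
    also have "\<dots> \<le> e"
      using nt \<alpha> by (simp add: field_simps)
    finally have "measure lebesgue ?U \<le> e" .
    moreover have "?U \<in> lmeasurable"
      by (rule fmeasurable.Un[OF Um negligible_imp_measurable[OF fin]])
    moreover have "?E \<subseteq> ?U"
    proof
      fix x assume x: "x \<in> ?E"
      show "x \<in> ?U"
      proof (cases "x \<in> t ` {..n}")
        case False
        from x obtain i where i: "i < n" "t i < x" "x \<le> t (Suc i)"
          using between_sequence_values[of t x n] t by auto
        moreover have "x \<noteq> t (Suc i)" using False i(1) by auto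
        ultimately have "x \<in> T i" using T(1)[OF i(1)] x by auto
        then show ?thesis using i(1) by auto
      qed auto
    qed
    ultimately show "\<exists>T. ?E \<subseteq> T \<and> T \<in> lmeasurable \<and> measure lebesgue T \<le> e"
      by blast
  qed
qed

text \<open>The slopes of \<open>f\<close> are dominated by those of its increasing variation
  function, so the set is steep for that function at every rate \<alpha>, and its outer measure is
  at most a constant divided by \<alpha>.\<close>

lemma negligible_infinite_slopes:
  assumes bv: "variation_bounded f {c..d} M" and cd: "c \<le> d"
  shows "negligible {x\<in>{c<..<d}. \<forall>\<alpha>. \<exists>\<^sub>F y in at x. \<alpha> \<le> \<bar>(f y - f x) / (y - x)\<bar>}" (is "negligible ?E")
proof -
  obtain V where V: "\<And>x y. c \<le> x \<Longrightarrow> x \<le> y \<Longrightarrow> y \<le> d \<Longrightarrow> \<bar>f y - f x\<bar> \<le> V y - V x"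
    by (rule variation_function_exists[OF bv cd]) blast
  then have mono: "mono_on {c..d} V"
    unfolding mono_on_def by (smt (verit) atLeastAtMost_iff)
  have Vcd: "V c \<le> V d" using V[of c d] cd by auto
  show ?thesis
    unfolding negligible_outer_le
  proof (intro allI impI)
    fix e :: real assume e: "e > 0"
    \<comment> \<open>The \<open>+ 1\<close> keeps \<alpha> positive when \<open>V\<close> is
      constant.\<close>
    define \<alpha> where "\<alpha> = (V d - V c + 1) / e"
    have \<alpha>: "\<alpha> > 0" using e Vcd by (simp add: \<alpha>_def)
    have "\<exists>T. ?E \<subseteq> T \<and> T \<in> lmeasurable \<and> measure lebesgue T \<le> (V d - V c) / \<alpha>"
    proof (rule mono_steep_set_measure_le[OF mono cd \<alpha>], rule conjI)
      fix x assume x: "x \<in> ?E"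
      then show "x \<in> {c<..<d}" by simp
      from x have fr: "\<exists>\<^sub>F y in at x. \<alpha> \<le> \<bar>(f y - f x) / (y - x)\<bar>" by simp
      have ev: "\<forall>\<^sub>F y in at x. y \<in> {c<..<d}" "\<forall>\<^sub>F y in at x. y \<noteq> x"
        using x by (intro eventually_at_in_open' open_greaterThanLessThan)
          (auto simp: eventually_at_filter)
      show "\<exists>\<^sub>F y in at x. \<alpha> * \<bar>y - x\<bar> \<le> \<bar>V y - V x\<bar>"
      proof (rule frequently_rev_mp[OF fr], rule eventually_mono[OF eventually_conj[OF ev]], rule impI)
        fix y assume y: "y \<in> {c<..<d} \<and> y \<noteq> x" and le: "\<alpha> \<le> \<bar>(f y - f x) / (y - x)\<bar>"
        have "\<alpha> * \<bar>y - x\<bar> \<le> \<bar>f y - f x\<bar>"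
          using le y by (simp add: abs_divide field_simps)
        also have "\<dots> \<le> \<bar>V y - V x\<bar>"
          using V[of x y] V[of y x] x y by (cases "x \<le> y") auto
        finally show "\<alpha> * \<bar>y - x\<bar> \<le> \<bar>V y - V x\<bar>" .
      qed
    qed
    moreover have "(V d - V c) / \<alpha> \<le> e"
      using \<alpha> e Vcd by (simp add: \<alpha>_def field_simps)
    ultimately show "\<exists>T. ?E \<subseteq> T \<and> T \<in> lmeasurable \<and> measure lebesgue T \<le> e"
      by (meson order_trans)
  qed
qed

text \<open>If \<open>f\<close> is not differentiable at x, either its slopes at x are unbounded or
  their lower and upper limits are separated by rationals p < q. Both alternatives give null sets,
  the second as a countable union over p and q.\<close>

lemma variation_bounded_imp_differentiable_ae:
  assumes bv: "variation_bounded f {c..d} M" and cd: "c \<le> d"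
  shows "negligible {x\<in>{c<..<d}. \<not> f differentiable (at x)}"
proof -
  define s where "s x y = (f y - f x) / (y - x)" for x y
  define E where "E p q = {x\<in>{c<..<d}. (\<exists>\<^sub>F y in at x. s x y \<le> p) \<and> (\<exists>\<^sub>F y in at x. s x y \<ge> q)}" for p q
  define Z where "Z = {x\<in>{c<..<d}. \<forall>\<alpha>. \<exists>\<^sub>F y in at x. \<alpha> \<le> \<bar>s x y\<bar>}"
  have E: "negligible (E p q)" if "p < q" for p q
  proof -
    \<comment> \<open>subtracting a linear function makes slopes below \<open>p\<close> and above \<open>q\<close> opposite\<close>
    define m \<alpha> where "m = (p + q) / 2" and "\<alpha> = (q - p) / 2"
    define g where "g x = f x - m * x" for x
    have "\<exists>M. variation_bounded g {c..d} M"
      using variation_bounded_diff_linear[OF bv] unfolding g_def by blast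
    moreover have "(g y - g x) / (y - x) = s x y - m" if "y \<noteq> x" for x y
      using that by (simp add: g_def s_def field_simps)
    then have "\<forall>\<^sub>F y in at x. (g y - g x) / (y - x) = s x y - m" for x
      by (auto simp: eventually_at_filter)
    then have "(\<exists>\<^sub>F y in at x. (g y - g x) / (y - x) \<le> - \<alpha>) \<longleftrightarrow> (\<exists>\<^sub>F y in at x. s x y - m \<le> - \<alpha>)"
      "(\<exists>\<^sub>F y in at x. (g y - g x) / (y - x) \<ge> \<alpha>) \<longleftrightarrow> (\<exists>\<^sub>F y in at x. s x y - m \<ge> \<alpha>)" for x
      by (auto intro!: frequently_cong)
    moreover have "s x y - m \<le> - \<alpha> \<longleftrightarrow> s x y \<le> p" "s x y - m \<ge> \<alpha> \<longleftrightarrow> s x y \<ge> q" for x y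
      by (auto simp: m_def \<alpha>_def field_simps)
    ultimately show ?thesis
      using negligible_opposite_slopes[of g c d _ \<alpha>] cd that by (auto simp: E_def \<alpha>_def)
  qed
  have "{x\<in>{c<..<d}. \<not> f differentiable (at x)}
      \<subseteq> Z \<union> (\<Union>(p, q)\<in>{(p, q). p \<in> \<rat> \<and> q \<in> \<rat> \<and> p < q}. E p q)"
  proof
    fix x assume "x \<in> {x\<in>{c<..<d}. \<not> f differentiable (at x)}"
    then have x: "x \<in> {c<..<d}" and nd: "\<not> f differentiable (at x)" by auto
    show "x \<in> Z \<union> (\<Union>(p, q)\<in>{(p, q). p \<in> \<rat> \<and> q \<in> \<rat> \<and> p < q}. E p q)"
    proof (rule ccontr)
      assume not: "\<not> ?thesis"
      let ?S = "\<lambda>y. ereal (s x y)"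
      obtain \<alpha> where \<alpha>: "\<forall>\<^sub>F y in at x. \<bar>s x y\<bar> < \<alpha>"
        using not x by (auto simp: Z_def not_frequently not_le)
      have eq: "Liminf (at x) ?S = Limsup (at x) ?S"
      proof (rule ccontr)
        assume "Liminf (at x) ?S \<noteq> Limsup (at x) ?S"
        then have "Liminf (at x) ?S < Limsup (at x) ?S"
          using Liminf_le_Limsup[of "at x" ?S] by auto
        \<comment> \<open>The real levels p' < q' in the gap leave room for rationals p and q
          strictly between them. If slopes at most p did not recur, the lower limit would be at
          least p', and similarly for q and the upper limit.\<close>
        then obtain q' where q': "Liminf (at x) ?S < ereal q'" "ereal q' < Limsup (at x) ?S"
          using ereal_dense2 by blast
        then obtain p' where p': "Liminf (at x) ?S < ereal p'" "p' < q'"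
          using ereal_dense2 by (metis less_ereal.simps(1))
        obtain p where p: "p \<in> \<rat>" "p' < p" "p < q'" using Rats_dense_in_real[OF p'(2)] by blast
        obtain q where q: "q \<in> \<rat>" "p < q" "q < q'" using Rats_dense_in_real[OF p(3)] by blast
        have "\<exists>\<^sub>F y in at x. s x y \<le> p"
        proof (rule ccontr)
          assume "\<not> ?thesis"
          then have "\<forall>\<^sub>F y in at x. ereal p' \<le> ?S y"
            using p by (auto simp: not_frequently not_le elim!: eventually_mono)
          then have "ereal p' \<le> Liminf (at x) ?S" by (rule Liminf_bounded)
          then show False using p'(1) by simp
        qed
        moreover have "\<exists>\<^sub>F y in at x. s x y \<ge> q"
        proof (rule ccontr)
          assume "\<not> ?thesis"
          then have "\<forall>\<^sub>F y in at x. ?S y \<le> ereal q'"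
            using q by (auto simp: not_frequently not_le elim!: eventually_mono)
          then have "Limsup (at x) ?S \<le> ereal q'" by (rule Limsup_bounded)
          then show False using q'(2) by simp
        qed
        ultimately have "x \<in> E p q" using x by (simp add: E_def)
        then show False using not p q by blast
      qed
      define l where "l = Liminf (at x) ?S"
      have lim: "(?S \<longlongrightarrow> l) (at x)"
        using eq by (intro Liminf_eq_Limsup) (auto simp: l_def)
      \<comment> \<open>The eventual bound on the slopes excludes infinite limits.\<close>
      have "l \<le> ereal \<alpha>" "ereal (- \<alpha>) \<le> l"
        using \<alpha> by (auto intro!: tendsto_upperbound[OF lim] tendsto_lowerbound[OF lim] elim!: eventually_mono)
      then obtain L where "l = ereal L" by (cases l) auto
      then have "(s x \<longlongrightarrow> L) (at x)" using lim by simp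
      then have "(f has_field_derivative L) (at x)"
        by (simp add: has_field_derivative_iff s_def[abs_def])
      then show False using nd real_differentiable_def by blast
    qed
  qed
  moreover have "countable {(p, q). p \<in> \<rat> \<and> q \<in> (\<rat> :: real set) \<and> p < q}"
    by (rule countable_subset[of _ "\<rat> \<times> \<rat>"]) (auto intro: countable_rat)
  then have "negligible (\<Union>(p, q)\<in>{(p, q). p \<in> \<rat> \<and> q \<in> \<rat> \<and> p < q}. E p q)"
    using E by (intro negligible_countable_Union) auto
  moreover have "negligible Z"
    using negligible_infinite_slopes[OF bv cd] by (simp add: Z_def s_def)
  ultimately show ?thesis by (meson negligible_Un negligible_subset)
qed

section \<open>The fundamental theorem of calculus for absolutely continuous functions\<close>

text \<open>This is absolute continuity with \<epsilon> = 1: every subdivision of an interval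
  shorter than \<delta> has total length below \<delta>.\<close>

lemma absolutely_continuous_variation_bounded:
  assumes ac: "absolutely_continuous_fun_on S f"
  shows "\<exists>\<delta>>0. \<forall>c d. {c..d} \<subseteq> S \<and> d - c < \<delta> \<longrightarrow> variation_bounded f {c..d} 1"
proof -
  obtain \<delta> where \<delta>: "\<delta> > 0" and
    ac1: "\<And>D T. D division_of T \<Longrightarrow> T \<subseteq> S \<Longrightarrow> (\<Sum>K\<in>D. Sup K - Inf K) < \<delta> \<Longrightarrow>
        (\<Sum>K\<in>D. \<bar>f (Sup K) - f (Inf K)\<bar>) < 1"
    using ac zero_less_one unfolding absolutely_continuous_fun_on_def by metis
  have "variation_bounded f {c..d} 1" if cd: "{c..d} \<subseteq> S" "d - c < \<delta>" for c d
    unfolding variation_bounded_def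
  proof (intro allI impI)
    fix n and t :: "nat \<Rightarrow> real"
    assume "(\<forall>i<n. t i \<le> t (Suc i)) \<and> (\<forall>i\<le>n. t i \<in> {c..d})"
    then have t: "\<And>i. i < n \<Longrightarrow> t i \<le> t (Suc i)" "\<And>i. i \<le> n \<Longrightarrow> t i \<in> {c..d}" by auto
    have tm: "t i \<le> t j" if "i \<le> j" "j \<le> n" for i j
      using that
    proof (induction j)
      case (Suc j)
      then show ?case using t(1)[of j] by (cases "i = Suc j") (auto simp: le_Suc_eq)
    qed auto
    \<comment> \<open>A division is a set of intervals. Dropping the degenerate ones makes
      \<open>J\<close> injective, so that sums over intervals equal sums over indices; the dropped
      increments of \<open>f\<close> vanish.\<close>
    define I where "I = {i. i < n \<and> t i < t (Suc i)}"
    define J where "J i = {t i..t (Suc i)}" for i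
    have I: "finite I" "I \<subseteq> {..<n}" by (auto simp: I_def)
    have SI: "Sup (J i) = t (Suc i)" "Inf (J i) = t i" if "i \<in> I" for i
      using that by (auto simp: I_def J_def)
    have disj: "interior (J i) \<inter> interior (J j) = {}" if "i < j" "i \<in> I" "j \<in> I" for i j
      using tm[of "Suc i" j] that by (auto simp: I_def J_def)
    have inj: "inj_on J I"
    proof (rule inj_onI)
      fix i j assume ij: "i \<in> I" "j \<in> I" "J i = J j"
      have "interior (J i) \<noteq> {}" using ij(1) by (auto simp: J_def I_def)
      then show "i = j" using disj[of i j] disj[of j i] ij by (metis inf.idem linorder_neqE_nat)
    qed
    have div: "(J ` I) division_of (\<Union>(J ` I))"
    proof (rule division_ofI)
      fix K assume "K \<in> J ` I"
      then obtain i where i: "i \<in> I" "K = J i" by blast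
      then show "K \<noteq> {}" "\<exists>a b. K = cbox a b"
        by (auto simp: J_def I_def)
      show "K \<subseteq> \<Union>(J ` I)" using \<open>K \<in> J ` I\<close> by blast
      fix K' assume "K' \<in> J ` I" "K \<noteq> K'"
      then obtain j where j: "j \<in> I" "K' = J j" "i \<noteq> j" using i by blast
      then show "interior K \<inter> interior K' = {}"
        using disj[of i j] disj[of j i] i by (metis Int_commute linorder_neqE_nat)
    qed (use I in auto)
    have sub: "\<Union>(J ` I) \<subseteq> S"
    proof -
      have "J i \<subseteq> {c..d}" if "i \<in> I" for i
        using t(2)[of i] t(2)[of "Suc i"] that by (auto simp: J_def I_def)
      then show ?thesis using cd(1) by blast
    qed
    have "(\<Sum>K\<in>J ` I. Sup K - Inf K) = (\<Sum>i\<in>I. t (Suc i) - t i)"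
      by (simp add: sum.reindex[OF inj] SI)
    also have "\<dots> \<le> (\<Sum>i<n. t (Suc i) - t i)"
      using I t(1) by (intro sum_mono2) auto
    also have "\<dots> = t n - t 0" by (simp add: sum_lessThan_telescope)
    also have "\<dots> < \<delta>" using t(2)[of 0] t(2)[of n] cd(2) by simp
    finally have "(\<Sum>K\<in>J ` I. \<bar>f (Sup K) - f (Inf K)\<bar>) < 1"
      by (intro ac1[OF div sub])
    also have "(\<Sum>K\<in>J ` I. \<bar>f (Sup K) - f (Inf K)\<bar>) = (\<Sum>i\<in>I. \<bar>f (t (Suc i)) - f (t i)\<bar>)"
      by (simp add: sum.reindex[OF inj] SI)
    also have "\<dots> = (\<Sum>i<n. \<bar>f (t (Suc i)) - f (t i)\<bar>)"
    proof (rule sum.mono_neutral_left)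
      show "\<forall>i\<in>{..<n} - I. \<bar>f (t (Suc i)) - f (t i)\<bar> = 0"
        using t(1) by (force simp: I_def)
    qed (use I in auto)
    finally show "(\<Sum>i<n. \<bar>f (t (Suc i)) - f (t i)\<bar>) \<le> 1" by simp
  qed
  with \<delta> show ?thesis by blast
qed

text \<open>Variation is bounded on pieces shorter than \<delta>. The pieces with rational endpoints
  are countably many, and their interiors cover the open interval.\<close>

lemma absolutely_continuous_imp_differentiable_ae:
  assumes ac: "absolutely_continuous_fun_on {a..b} f"
  shows "negligible {x\<in>{a<..<b}. \<not> f differentiable (at x)}"
proof -
  obtain \<delta> where \<delta>: "\<delta> > 0"
    and bv: "\<And>c d. {c..d} \<subseteq> {a..b} \<Longrightarrow> d - c < \<delta> \<Longrightarrow> variation_bounded f {c..d} 1"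
    using absolutely_continuous_variation_bounded[OF ac] by blast
  define P where "P = {(p, q). p \<in> \<rat> \<and> q \<in> \<rat> \<and> a \<le> p \<and> p < q \<and> q \<le> b \<and> q - p < \<delta>}"
  define E where "E p q = {x\<in>{p<..<q}. \<not> f differentiable (at x)}" for p q
  have "countable P"
    unfolding P_def by (rule countable_subset[of _ "\<rat> \<times> \<rat>"]) (auto intro: countable_rat)
  moreover have "negligible (E p q)" if "(p, q) \<in> P" for p q
  proof -
    have "variation_bounded f {p..q} 1" "p \<le> q"
      using that by (auto simp: P_def intro!: bv)
    then show ?thesis
      unfolding E_def by (rule variation_bounded_imp_differentiable_ae)
  qed
  ultimately have "negligible (\<Union>(p, q)\<in>P. E p q)"
    by (intro negligible_countable_Union) auto
  moreover have "{x\<in>{a<..<b}. \<not> f differentiable (at x)} \<subseteq> (\<Union>(p, q)\<in>P. E p q)"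
  proof
    fix x assume x: "x \<in> {x\<in>{a<..<b}. \<not> f differentiable (at x)}"
    obtain p where p: "p \<in> \<rat>" "max a (x - \<delta> / 2) < p" "p < x"
      using Rats_dense_in_real[of "max a (x - \<delta> / 2)" x] x \<delta> by auto
    obtain q where q: "q \<in> \<rat>" "x < q" "q < min b (x + \<delta> / 2)"
      using Rats_dense_in_real[of x "min b (x + \<delta> / 2)"] x \<delta> by auto
    have "(p, q) \<in> P" "x \<in> E p q"
      using p q x by (auto simp: P_def E_def)
    then show "x \<in> (\<Union>(p, q)\<in>P. E p q)" by blast
  qed
  ultimately show ?thesis by (rule negligible_subset)
qed

text \<open>The straddle lemma: the increment is split at the tag \<open>x\<close>, and since
  \<open>x\<close> lies between \<open>u\<close> and \<open>v\<close> the two errors add up to a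
  multiple of v - u.\<close>

lemma derivative_straddle:
  fixes f :: "real \<Rightarrow> real"
  assumes "(f has_real_derivative D) (at x)" "e > 0"
  shows "\<exists>d>0. \<forall>u v. u \<le> x \<and> x \<le> v \<and> {u..v} \<subseteq> ball x d \<longrightarrow>
     \<bar>f v - f u - D * (v - u)\<bar> \<le> e * (v - u)"
proof -
  have "(f has_derivative (\<lambda>h. D * h)) (at x)"
    using assms(1) by (simp add: has_field_derivative_def)
  then obtain d where d: "d > 0"
    and le: "\<And>y. norm (y - x) < d \<Longrightarrow> norm (f y - f x - D * (y - x)) \<le> e * norm (y - x)"
    using assms(2) unfolding has_derivative_at_alt by blast
  have "\<bar>f v - f u - D * (v - u)\<bar> \<le> e * (v - u)"
    if uv: "u \<le> x" "x \<le> v" "{u..v} \<subseteq> ball x d" for u v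
  proof -
    have "u \<in> {u..v}" "v \<in> {u..v}" using uv by auto
    then have "\<bar>u - x\<bar> < d" "\<bar>v - x\<bar> < d" using uv(3) by (auto simp: dist_real_def)
    then have "\<bar>f v - f x - D * (v - x)\<bar> \<le> e * (v - x)" "\<bar>f u - f x - D * (u - x)\<bar> \<le> e * (x - u)"
      using le[of v] le[of u] uv by auto
    moreover have "f v - f u - D * (v - u) = (f v - f x - D * (v - x)) - (f u - f x - D * (u - x))"
      by (simp add: algebra_simps)
    moreover have "e * (v - u) = e * (v - x) + e * (x - u)"
      by (simp add: algebra_simps)
    ultimately show ?thesis by linarith
  qed
  then show ?thesis using d by blast
qed

text \<open>The increments of \<open>f\<close> over a tagged division telescope to f b - f a and are
  compared with the Riemann sum term by term. Straddling controls the tags where \<open>f\<close> is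
  differentiable, absolute continuity the others. The integral is a gauge integral; absolute
  integrability is obtained later from the energy.\<close>

lemma absolutely_continuous_has_integral_deriv:
  assumes ac: "absolutely_continuous_fun_on {a..b} f" and ab: "a \<le> b"
  shows "(deriv f has_integral f b - f a) {a..b}"
proof -
  define N where "N = {x\<in>{a..b}. \<not> f differentiable (at x)}"
  have "N \<subseteq> {x\<in>{a<..<b}. \<not> f differentiable (at x)} \<union> {a, b}"
    by (auto simp: N_def)
  moreover have "negligible ({x\<in>{a<..<b}. \<not> f differentiable (at x)} \<union> {a, b})"
    using absolutely_continuous_imp_differentiable_ae[OF ac] by (intro negligible_Un) auto
  ultimately have N: "negligible N" using negligible_subset by blast
  \<comment> \<open>With value 0 on \<open>N\<close>, a term tagged in \<open>N\<close> contributes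
    only its increment of \<open>f\<close> to the error.\<close>
  define g where "g x = (if x \<in> N then 0 else deriv f x)" for x
  have "(g has_integral f b - f a) (cbox a b)"
    unfolding has_integral
  proof (intro allI impI)
    fix e :: real assume e: "e > 0"
    \<comment> \<open>The total straddling error is \<open>e1 * (b - a)\<close>, at most e / 2; the
      \<open>+ 1\<close> covers a = b.\<close>
    define e1 where "e1 = e / (2 * (b - a + 1))"
    have e1: "e1 > 0" using e ab by (simp add: e1_def)
    obtain \<delta> where \<delta>: "\<delta> > 0" and
      ac1: "\<And>D T. D division_of T \<Longrightarrow> T \<subseteq> {a..b} \<Longrightarrow> (\<Sum>K\<in>D. Sup K - Inf K) < \<delta> \<Longrightarrow>
        (\<Sum>K\<in>D. \<bar>f (Sup K) - f (Inf K)\<bar>) < e / 2"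
      using ac e unfolding absolutely_continuous_fun_on_def by (metis half_gt_zero)
    \<comment> \<open>division intervals tagged in \<open>N\<close> will lie in \<open>U\<close>, so absolute continuity controls their increments\<close>
    obtain U where U: "open U" "N \<subseteq> U" "U \<in> lmeasurable" "measure lebesgue U < \<delta>"
    proof -
      obtain U where U: "open U" "N \<subseteq> U" "U - N \<in> lmeasurable" "emeasure lebesgue (U - N) < ennreal \<delta>"
        using sets_lebesgue_outer_open[OF negligible_imp_sets[OF N] \<delta>] by blast
      have eq: "(U - N) \<union> N = U" using U(2) by blast
      have "U \<in> lmeasurable"
        using fmeasurable.Un[OF U(3) negligible_imp_measurable[OF N]] eq by simp
      moreover have "measure lebesgue U \<le> measure lebesgue (U - N) + measure lebesgue N"
        using measure_Un_le[of "U - N" lebesgue N] U(3) negligible_imp_sets[OF N] eq by auto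
      moreover have "measure lebesgue (U - N) < \<delta>"
        using U(4) \<delta> emeasure_eq_measure2[OF U(3)] by (simp add: ennreal_less_iff)
      ultimately show ?thesis using that U negligible_imp_measure0[OF N] by simp
    qed
    define R where "R x d \<longleftrightarrow> d > 0 \<and> (x \<in> N \<longrightarrow> ball x d \<subseteq> U) \<and>
       (x \<in> {a..b} - N \<longrightarrow> (\<forall>u v. u \<le> x \<and> x \<le> v \<and> {u..v} \<subseteq> ball x d \<longrightarrow>
           \<bar>f v - f u - g x * (v - u)\<bar> \<le> e1 * (v - u)))" for x d
    have "\<exists>d. R x d" for x
    proof (cases "x \<in> N")
      case True
      then obtain d where "d > 0" "ball x d \<subseteq> U" using openE[OF U(1)] U(2) by blast
      then show ?thesis using True by (auto simp: R_def)
    next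
      case False
      show ?thesis
      proof (cases "x \<in> {a..b}")
        case True
        then have "f differentiable (at x)" using False by (simp add: N_def)
        then have "(f has_real_derivative g x) (at x)"
          using False by (metis DERIV_imp_deriv g_def real_differentiable_def)
        from derivative_straddle[OF this e1] show ?thesis using False by (auto simp: R_def)
      qed (use False in \<open>auto simp: R_def intro: zero_less_one\<close>)
    qed
    then obtain r where "\<And>x. R x (r x)" by metis
    then have r: "r x > 0" "x \<in> N \<Longrightarrow> ball x (r x) \<subseteq> U"
      "x \<in> {a..b} - N \<Longrightarrow> u \<le> x \<Longrightarrow> x \<le> v \<Longrightarrow> {u..v} \<subseteq> ball x (r x) \<Longrightarrow>
           \<bar>f v - f u - g x * (v - u)\<bar> \<le> e1 * (v - u)" for x u v
      unfolding R_def by blast+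
    have "norm ((\<Sum>(x, K)\<in>p. measure lborel K *\<^sub>R g x) - (f b - f a)) < e"
      if p: "p tagged_division_of cbox a b" "(\<lambda>x. ball x (r x)) fine p" for p
    proof -
      define F where "F = (\<lambda>(x, K). measure lborel K *\<^sub>R g x - (f (Sup K) - f (Inf K)))"
      have fin: "finite p" using p(1) by blast
      have pK: "x \<in> K \<and> K = {Inf K..Sup K} \<and> Inf K \<le> x \<and> x \<le> Sup K \<and> measure lborel K = Sup K - Inf K
           \<and> K \<subseteq> {a..b} \<and> x \<in> {a..b} \<and> K \<subseteq> ball x (r x)" if xK: "(x, K) \<in> p" for x K
      proof -
        obtain u v where uv: "K = cbox u v" using tagged_division_ofD(4)[OF p(1) xK] by blast
        have x: "x \<in> K" "K \<subseteq> {a..b}" using tagged_division_ofD(2,3)[OF p(1) xK] by auto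
        have "K \<subseteq> ball x (r x)" using p(2) xK by (auto simp: fine_def)
        moreover have "u \<le> v" using x uv by auto
        ultimately show ?thesis using x uv by auto
      qed
      have "(\<Sum>(x, K)\<in>p. f (Sup K) - f (Inf K)) = f b - f a"
        using additive_tagged_division_1[OF ab, of p f] p(1) by simp
      then have "norm ((\<Sum>(x, K)\<in>p. measure lborel K *\<^sub>R g x) - (f b - f a)) = \<bar>\<Sum>z\<in>p. F z\<bar>"
        by (simp add: F_def case_prod_unfold sum_subtractf)
      also have "\<dots> \<le> (\<Sum>z\<in>p. \<bar>F z\<bar>)" by (rule sum_abs)
      also have "\<dots> = (\<Sum>z\<in>{z\<in>p. fst z \<in> N}. \<bar>F z\<bar>) + (\<Sum>z\<in>{z\<in>p. fst z \<notin> N}. \<bar>F z\<bar>)"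
        using fin by (subst sum.union_disjoint[symmetric]) (auto intro!: sum.cong)
      also have "\<dots> < e / 2 + e / 2"
      proof (rule add_less_le_mono)
        define p' where "p' = {z\<in>p. fst z \<in> N}"
        \<comment> \<open>Different tagged pairs may share a degenerate interval. Without these,
          \<open>snd\<close> is injective and the pairs become a division; the omitted pairs have
          \<open>F\<close> equal to 0.\<close>
        define q where "q = {z\<in>p'. measure lborel (snd z) \<noteq> 0}"
        have q: "finite q" "q \<subseteq> p" using fin by (auto simp: q_def p'_def)
        have qd: "interior (snd z) \<inter> interior (snd z') = {}" if "z \<in> q" "z' \<in> q" "z \<noteq> z'" for z z'
          using tagged_division_ofD(5)[OF p(1), of "fst z" "snd z" "fst z'" "snd z'"] that q(2)
          by (cases z, cases z') auto
        have qi: "interior (snd z) \<noteq> {}" if z: "z \<in> q" for z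
        proof -
          have "K = {Inf K..Sup K}" "measure lborel K = Sup K - Inf K" "Inf K \<le> Sup K" if "K = snd z" for K
            using pK[of "fst z" K] z q(2) that by auto
          moreover have "measure lborel (snd z) \<noteq> 0" using z by (simp add: q_def)
          ultimately have "Inf (snd z) < Sup (snd z)" by force
          then have "interior {Inf (snd z)..Sup (snd z)} \<noteq> {}" by simp
          then show ?thesis using \<open>\<And>K. K = snd z \<Longrightarrow> K = {Inf K..Sup K}\<close>[OF refl] by simp
        qed
        have inj: "inj_on snd q"
          using qd qi by (intro inj_onI) (metis inf.idem)
        have div: "snd ` q division_of \<Union>(snd ` q)"
        proof (rule division_ofI)
          fix K assume "K \<in> snd ` q"
          then obtain z where z: "z \<in> q" "K = snd z" by blast
          then have "(fst z, K) \<in> p" using q(2) by auto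
          then show "K \<noteq> {}" "\<exists>a b. K = cbox a b"
            using pK tagged_division_ofD(4)[OF p(1)] by blast+
          show "K \<subseteq> \<Union>(snd ` q)" using \<open>K \<in> snd ` q\<close> by blast
          fix K' assume "K' \<in> snd ` q" "K \<noteq> K'"
          then show "interior K \<inter> interior K' = {}" using qd z by blast
        qed (use q in auto)
        have qp: "(fst z, snd z) \<in> p" "fst z \<in> N" if "z \<in> q" for z
          using that by (auto simp: q_def p'_def)
        have sub: "\<Union>(snd ` q) \<subseteq> {a..b}" using pK qp(1) by blast
        have sU: "\<Union>(snd ` q) \<subseteq> U" using pK[OF qp(1)] r(2)[OF qp(2)] by blast
        have "(\<Sum>K\<in>snd ` q. Sup K - Inf K) = (\<Sum>K\<in>snd ` q. measure lborel K)"
          using pK[OF qp(1)] by (intro sum.cong) auto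
        also have "\<dots> = measure lebesgue (\<Union>(snd ` q))"
        proof -
          have "measure lborel K = measure lebesgue K" if "K \<in> snd ` q" for K
            using division_ofD(4)[OF div that] by auto
          then show ?thesis using content_division[OF div] by simp
        qed
        also have "\<dots> \<le> measure lebesgue U"
          using sU U(3) fmeasurableD[OF lmeasurable_division[OF div]]
          by (intro measure_mono_fmeasurable)
        also have "\<dots> < \<delta>" by (rule U(4))
        finally have lt: "(\<Sum>K\<in>snd ` q. \<bar>f (Sup K) - f (Inf K)\<bar>) < e / 2"
          by (intro ac1[OF div sub])
        have "(\<Sum>z\<in>p'. \<bar>F z\<bar>) = (\<Sum>z\<in>q. \<bar>F z\<bar>)"
        proof (rule sum.mono_neutral_right)
          show "\<forall>z\<in>p' - q. \<bar>F z\<bar> = 0"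
          proof
            fix z assume z: "z \<in> p' - q"
            then have "measure lborel (snd z) = 0" "(fst z, snd z) \<in> p" by (auto simp: q_def p'_def)
            then have "measure lborel (snd z) = 0" "Sup (snd z) = Inf (snd z)"
              using pK[of "fst z" "snd z"] by auto
            then show "\<bar>F z\<bar> = 0" by (simp add: F_def case_prod_unfold)
          qed
        qed (use fin in \<open>auto simp: q_def p'_def\<close>)
        also have "\<dots> = (\<Sum>z\<in>q. \<bar>f (Sup (snd z)) - f (Inf (snd z))\<bar>)"
          using qp(2) by (intro sum.cong) (auto simp: F_def g_def case_prod_unfold abs_minus_commute)
        also have "\<dots> = (\<Sum>K\<in>snd ` q. \<bar>f (Sup K) - f (Inf K)\<bar>)"
          by (simp add: sum.reindex[OF inj])
        finally show "(\<Sum>z\<in>{z\<in>p. fst z \<in> N}. \<bar>F z\<bar>) < e / 2"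
          using lt by (simp add: p'_def)
      next
        have "(\<Sum>z\<in>{z\<in>p. fst z \<notin> N}. \<bar>F z\<bar>) \<le> (\<Sum>z\<in>{z\<in>p. fst z \<notin> N}. e1 * measure lborel (snd z))"
        proof (rule sum_mono)
          fix z assume "z \<in> {z\<in>p. fst z \<notin> N}"
          then have z: "(fst z, snd z) \<in> p" "fst z \<notin> N" by auto
          note * = pK[OF z(1)]
          have "\<bar>f (Sup (snd z)) - f (Inf (snd z)) - g (fst z) * (Sup (snd z) - Inf (snd z))\<bar>
              \<le> e1 * (Sup (snd z) - Inf (snd z))"
            using * z(2) by (intro r(3)) auto
          then show "\<bar>F z\<bar> \<le> e1 * measure lborel (snd z)"
            using * by (simp add: F_def case_prod_unfold abs_minus_commute mult.commute)
        qed
        also have "\<dots> \<le> (\<Sum>z\<in>p. e1 * measure lborel (snd z))"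
          using fin e1 by (intro sum_mono2) auto
        also have "\<dots> = e1 * (b - a)"
          using additive_content_tagged_division[OF p(1)] ab
          by (simp add: sum_distrib_left[symmetric] case_prod_unfold)
        also have "\<dots> \<le> e / 2"
          using e ab by (simp add: e1_def field_simps)
        finally show "(\<Sum>z\<in>{z\<in>p. fst z \<notin> N}. \<bar>F z\<bar>) \<le> e / 2" .
      qed
      finally show ?thesis by simp
    qed
    moreover have "gauge (\<lambda>x. ball x (r x))"
      using r(1) by (rule gauge_ball_dependent[rule_format])
    ultimately show "\<exists>\<gamma>. gauge \<gamma> \<and> (\<forall>p. p tagged_division_of cbox a b \<and> \<gamma> fine p \<longrightarrow>
        norm ((\<Sum>(x, K)\<in>p. measure lborel K *\<^sub>R g x) - (f b - f a)) < e)"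
      by blast
  qed
  then have "(g has_integral f b - f a) {a..b}" by simp
  then show ?thesis
    by (rule has_integral_spike[OF N, rotated]) (simp add: g_def)
qed

section \<open>Weighted estimates for profiles\<close>

lemma ln_exp_div_gt_1: "0 < r \<Longrightarrow> r < 1 \<Longrightarrow> 1 < ln (exp 1 / r)" for r :: real
  by (simp add: ln_div)

text \<open>In the variable 1 - ln r the integrand is a pure power, with antiderivative
  \<open>P\<close>. Since 1 - ln r > 1 and 1 - \<beta> < 0, \<open>P\<close> takes values between 0
  and 1 / (\<beta> - 1), so the bound is uniform in \<open>a\<close> and \<open>b\<close>.\<close>

lemma nn_integral_log_weight_le:
  fixes \<beta> a b :: real
  assumes \<beta>: "\<beta> > 1" and ab: "0 < a" "a \<le> b" "b < 1"
  shows "(\<integral>\<^sup>+r. ennreal (1 / (r * ln (exp 1 / r) powr \<beta>)) \<partial>lebesgue_on {a..b}) \<le> ennreal (1 / (\<beta> - 1))"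
proof -
  define P where "P r = (1 - ln r) powr (1 - \<beta>) / (\<beta> - 1)" for r :: real
  define G where "G r = 1 / (r * ln (exp 1 / r) powr \<beta>)" for r :: real
  have L: "ln (exp 1 / r) = 1 - ln r" "1 - ln r > 1" if "r \<in> {a..b}" for r
    using that ab by (auto simp: ln_div)
  have "(P has_real_derivative G r) (at r)" if r: "r \<in> {a..b}" for r
  proof -
    have "ln r < 1" using L(2)[OF r] by linarith
    then have "((\<lambda>r. (1 - ln r) powr (1 - \<beta>)) has_real_derivative
        (1 - \<beta>) * (1 - ln r) powr (1 - \<beta> - 1) * (- (1 / r))) (at r)"
      using \<open>ln r < 1\<close> r ab by (auto intro!: derivative_eq_intros)
    then have "(P has_real_derivative
        (1 - \<beta>) * (1 - ln r) powr (1 - \<beta> - 1) * (- (1 / r)) / (\<beta> - 1)) (at r)"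
      unfolding P_def by (rule DERIV_cdivide)
    moreover have "(1 - \<beta>) * (1 - ln r) powr (1 - \<beta> - 1) * (- (1 / r)) / (\<beta> - 1) = G r"
    proof -
      have "(1 - ln r) powr (1 - \<beta> - 1) = 1 / (1 - ln r) powr \<beta>"
        by (simp add: powr_minus_divide)
      moreover have "r \<noteq> 0" "\<beta> - 1 \<noteq> 0" "(1 - ln r) powr \<beta> \<noteq> 0"
        using r ab \<beta> \<open>ln r < 1\<close> by auto
      ultimately show ?thesis
        unfolding G_def L(1)[OF r] by (simp add: divide_simps)
    qed
    ultimately show ?thesis by simp
  qed
  then have "(G has_integral P b - P a) {a..b}"
    using ab by (intro fundamental_theorem_of_calculus)
      (auto simp: has_real_derivative_iff_has_vector_derivative[symmetric]
            intro: has_field_derivative_at_within)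
  then have hi: "((\<lambda>r. \<bar>G r\<bar>) has_integral P b - P a) {a..b}"
    by (rule has_integral_eq[rotated]) (use ab in \<open>auto simp: G_def\<close>)
  have "(\<integral>\<^sup>+r. ennreal (G r) \<partial>lebesgue_on {a..b}) = (\<integral>\<^sup>+r. ennreal \<bar>G r\<bar> \<partial>lebesgue_on {a..b})"
    using ab by (intro nn_integral_cong) (auto simp: G_def space_restrict_space)
  also have "\<dots> = (\<integral>\<^sup>+r. ennreal (indicator {a..b} r * \<bar>G r\<bar>) \<partial>lborel)"
    by (subst nn_integral_restrict_space)
       (auto simp: nn_integral_completion indicator_def intro!: nn_integral_cong)
  also have "\<dots> = ennreal (P b - P a)"
    using hi by (intro nn_integral_has_integral_lebesgue) auto
  also have "\<dots> \<le> ennreal (1 / (\<beta> - 1))"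
  proof (rule ennreal_leI)
    have "P a \<ge> 0" using \<beta> by (simp add: P_def)
    moreover have "(1 - ln b) powr (1 - \<beta>) \<le> 1"
      using L(2)[of b] ab \<beta> powr_mono2'[of "1 - \<beta>" 1 "1 - ln b"] by auto
    then have "P b \<le> 1 / (\<beta> - 1)"
      using \<beta> by (simp add: P_def divide_right_mono)
    ultimately show "P b - P a \<le> 1 / (\<beta> - 1)" by simp
  qed
  finally show ?thesis by (simp add: G_def)
qed

text \<open>Either \<open>g\<close> already dominates \<open>y\<close>, or y / g > 1 and multiplying
  \<open>y\<close> by its \<open>k\<close>-th power only enlarges it.\<close>

lemma le_power_quotient_plus:
  fixes y g :: real
  assumes "0 \<le> y" "0 < g"
  shows "y \<le> y ^ (k + 1) / g ^ k + g"
proof (cases "y \<le> g")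
  case True
  then show ?thesis using assms by (simp add: add_increasing)
next
  case False
  then have "1 \<le> y / g" using assms by simp
  then have "y * 1 \<le> y * (y / g) ^ k"
    using assms by (intro mult_left_mono one_le_power) auto
  also have "\<dots> = y ^ (k + 1) / g ^ k" by (simp add: power_divide)
  finally show ?thesis using assms by simp
qed

text \<open>With \<open>G r = 1 / (r * L powr \<beta>)\<close>, \<open>L = ln (exp 1 / r)\<close>, the energy density is
  \<open>\<bar>h r\<bar> ^ (k + 1) / G r ^ k\<close>, so that the pointwise inequality \<open>le_power_quotient_plus\<close>, applied to
  \<open>\<bar>h r\<bar> / M\<close>, takes the place of Hoelder's inequality.\<close>

lemma increment_le_weighted_energy:
  fixes g h :: "real \<Rightarrow> real" and \<beta> M :: real
  assumes \<beta>: "\<beta> > 1" and M: "M > 0" and ab: "0 < a" "a \<le> b" "b < 1"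
    and hi: "(h has_integral g b - g a) {a..b}"
    and en: "(\<integral>\<^sup>+r\<in>{0<..<1}. ennreal (r ^ k * \<bar>h r\<bar> ^ (k + 1) * ln (exp 1 / r) powr (\<beta> * real k)) \<partial>lebesgue)
       \<le> ennreal (M ^ (k + 1))"
  shows "\<bar>g b - g a\<bar> \<le> M * (1 + 1 / (\<beta> - 1))"
proof -
  let ?N = "lebesgue_on {a..b}"
  define F where "F r = r ^ k * \<bar>h r\<bar> ^ (k + 1) * ln (exp 1 / r) powr (\<beta> * real k)" for r
  define G where "G r = 1 / (r * ln (exp 1 / r) powr \<beta>)" for r
  have hm[measurable]: "h \<in> borel_measurable ?N"
    using hi by (intro integrable_imp_measurable) (auto simp: has_integral_integrable)
  have bm: "f \<in> borel_measurable ?N" if "f \<in> borel_measurable borel" for f :: "real \<Rightarrow> real"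
    using that by (intro measurable_restrict_space1 measurable_completion) simp
  have [measurable]: "(\<lambda>r. r ^ k) \<in> borel_measurable ?N" "G \<in> borel_measurable ?N"
    "(\<lambda>r. ln (exp 1 / r) powr (\<beta> * real k)) \<in> borel_measurable ?N"
    by (intro bm; simp add: G_def[abs_def])+
  have Fm[measurable]: "F \<in> borel_measurable ?N"
    unfolding F_def[abs_def] by measurable
  have F0: "F r \<ge> 0" if "r \<in> {a..b}" for r using that ab by (simp add: F_def)
  have G0: "G r > 0" if "r \<in> {a..b}" for r
  proof -
    have "0 < r" "ln (exp 1 / r) \<noteq> 0" using that ab ln_exp_div_gt_1[of r] by auto
    then have "0 < ln (exp 1 / r) powr \<beta>" by (simp only: powr_gt_zero not_False_eq_True)
    with \<open>0 < r\<close> show ?thesis by (simp add: G_def del: powr_gt_zero)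
  qed
  \<comment> \<open>Scaling by \<open>M\<close> balances the two terms: the first integrates to at
    most M ^ (k + 1) / M ^ k = M, the second to at most M / (\<beta> - 1).\<close>
  have pt: "\<bar>h r\<bar> \<le> F r / M ^ k + M * G r" if r: "r \<in> {a..b}" for r
  proof -
    have "1 < ln (exp 1 / r)" using r ab by (intro ln_exp_div_gt_1) auto
    then have L: "ln (exp 1 / r) > 0" by linarith
    have "\<bar>h r\<bar> / M \<le> (\<bar>h r\<bar> / M) ^ (k + 1) / G r ^ k + G r"
      using M G0[OF r] by (intro le_power_quotient_plus) auto
    then have "\<bar>h r\<bar> \<le> M * ((\<bar>h r\<bar> / M) ^ (k + 1) / G r ^ k + G r)"
      using M by (simp add: field_simps)
    also have "(ln (exp 1 / r) powr \<beta>) ^ k = ln (exp 1 / r) powr (\<beta> * real k)"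
      using L by (simp add: powr_powr powr_realpow[symmetric])
    then have "M * ((\<bar>h r\<bar> / M) ^ (k + 1) / G r ^ k) = F r / M ^ k"
      using M by (simp add: F_def G_def power_divide power_mult_distrib field_simps)
    then have "M * ((\<bar>h r\<bar> / M) ^ (k + 1) / G r ^ k + G r) = F r / M ^ k + M * G r"
      by (simp add: distrib_left)
    finally show ?thesis .
  qed
  have "(\<integral>\<^sup>+r. ennreal (F r) \<partial>?N) = (\<integral>\<^sup>+r. ennreal (F r) * indicator {a..b} r \<partial>lebesgue)"
    by (subst nn_integral_restrict_space) auto
  also have "\<dots> \<le> (\<integral>\<^sup>+r\<in>{0<..<1}. ennreal (F r) \<partial>lebesgue)"
    using ab by (intro nn_integral_mono) (auto simp: indicator_def)
  also have "\<dots> \<le> ennreal (M ^ (k + 1))" using en by (simp add: F_def)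
  finally have FI: "(\<integral>\<^sup>+r. ennreal (F r) \<partial>?N) \<le> ennreal (M ^ (k + 1))" .
  have "(\<integral>\<^sup>+r. ennreal \<bar>h r\<bar> \<partial>?N) \<le> (\<integral>\<^sup>+r. ennreal (1 / M ^ k) * ennreal (F r) + ennreal M * ennreal (G r) \<partial>?N)"
  proof (rule nn_integral_mono)
    fix r assume "r \<in> space ?N"
    then have r: "r \<in> {a..b}" by (simp add: space_restrict_space)
    have "ennreal \<bar>h r\<bar> \<le> ennreal (1 / M ^ k * F r + M * G r)"
      using pt[OF r] by (intro ennreal_leI) simp
    also have "\<dots> = ennreal (1 / M ^ k) * ennreal (F r) + ennreal M * ennreal (G r)"
      using M F0[OF r] G0[OF r] by (simp add: ennreal_plus ennreal_mult less_imp_le del: times_divide_eq_left)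
    finally show "ennreal \<bar>h r\<bar> \<le> ennreal (1 / M ^ k) * ennreal (F r) + ennreal M * ennreal (G r)" .
  qed
  also have "\<dots> = ennreal (1 / M ^ k) * (\<integral>\<^sup>+r. ennreal (F r) \<partial>?N) + ennreal M * (\<integral>\<^sup>+r. ennreal (G r) \<partial>?N)"
    by (simp add: nn_integral_add nn_integral_cmult)
  also have "\<dots> \<le> ennreal (1 / M ^ k) * ennreal (M ^ (k + 1)) + ennreal M * ennreal (1 / (\<beta> - 1))"
    using FI nn_integral_log_weight_le[OF \<beta> ab] by (intro add_mono mult_left_mono) (auto simp: G_def)
  also have "\<dots> = ennreal (1 / M ^ k * M ^ (k + 1) + M * (1 / (\<beta> - 1)))"
    using M \<beta> by (simp add: ennreal_plus ennreal_mult del: times_divide_eq_left times_divide_eq_right power_Suc)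
  also have "1 / M ^ k * M ^ (k + 1) + M * (1 / (\<beta> - 1)) = M * (1 + 1 / (\<beta> - 1))"
    using M by (simp add: distrib_left)
  finally have hI: "(\<integral>\<^sup>+r. ennreal (norm (h r)) \<partial>?N) \<le> ennreal (M * (1 + 1 / (\<beta> - 1)))"
    by simp
  \<comment> \<open>The bound \<open>hI\<close> makes \<open>h\<close> Lebesgue integrable, and
    uniqueness of the gauge integral identifies its Lebesgue integral with the increment of
    \<open>g\<close>.\<close>
  have int: "integrable ?N h"
    using hI by (intro integrableI_bounded hm) (auto intro: le_less_trans)
  then have "(h has_integral integral\<^sup>L ?N h) {a..b}"
    by (intro has_integral_integral_lebesgue_on) auto
  then have "g b - g a = integral\<^sup>L ?N h"
    using hi has_integral_unique by blast
  then have "ennreal \<bar>g b - g a\<bar> \<le> ennreal (M * (1 + 1 / (\<beta> - 1)))"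
    using order_trans[OF integral_norm_bound_ennreal[OF int] hI] by simp
  then show ?thesis
    using M \<beta> by (subst (asm) ennreal_le_iff) auto
qed

text \<open>At points where \<open>v\<close> is not differentiable \<open>deriv v\<close> has an unspecified value; these points form
  a null set for the functions considered here, but this is not part of the definition.\<close>

definition ftc_profile :: "(real \<Rightarrow> real) \<Rightarrow> bool" where
  "ftc_profile v \<longleftrightarrow> (v \<longlongrightarrow> 0) (at_left 1) \<and>
     (\<forall>a b. 0 < a \<and> a \<le> b \<and> b < 1 \<longrightarrow> (deriv v has_integral v b - v a) {a..b})"

text \<open>The increment bound does not depend on \<open>b\<close>, so letting b tend to 1 replaces
  the value at \<open>b\<close> by 0.\<close>

lemma ftc_profile_le_weighted_energy:
  fixes \<beta> M r :: real
  assumes \<beta>: "\<beta> > 1" and M: "M > 0" and v: "ftc_profile v" and r: "0 < r" "r < 1"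
    and en: "(\<integral>\<^sup>+r\<in>{0<..<1}. ennreal (r ^ k * \<bar>deriv v r\<bar> ^ (k + 1) * ln (exp 1 / r) powr (\<beta> * real k)) \<partial>lebesgue)
       \<le> ennreal (M ^ (k + 1))"
  shows "\<bar>v r\<bar> \<le> M * (1 + 1 / (\<beta> - 1))"
proof -
  have lim: "((\<lambda>b. \<bar>v b - v r\<bar>) \<longlongrightarrow> \<bar>0 - v r\<bar>) (at_left 1)"
    using v unfolding ftc_profile_def by (intro tendsto_intros) auto
  have "\<forall>\<^sub>F b in at_left 1. b \<in> {r<..<1}"
    using r by (intro eventually_at_leftI[of r]) auto
  then have "\<forall>\<^sub>F b in at_left 1. \<bar>v b - v r\<bar> \<le> M * (1 + 1 / (\<beta> - 1))"
  proof (rule eventually_mono)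
    fix b assume b: "b \<in> {r<..<1}"
    show "\<bar>v b - v r\<bar> \<le> M * (1 + 1 / (\<beta> - 1))"
      using v b r unfolding ftc_profile_def
      by (intro increment_le_weighted_energy[OF \<beta> M _ _ _ _ en]) auto
  qed
  from tendsto_upperbound[OF lim this] show ?thesis by simp
qed

section \<open>Radial functions on the ball\<close>

lemma radial_profile_unit:
  obtains e :: "real^'n::finite" where "norm e = 1" "\<And>u r. radial_profile u r = u (r *\<^sub>R e)"
proof -
  obtain e :: "real^'n" where "norm e = 1"
    using vector_choose_size[of 1] by auto
  then have "norm (SOME e::real^'n. norm e = 1) = 1"
    by (rule someI)
  then show thesis using that unfolding radial_profile_def by blast
qed

lemma radial_profile_w1:
  "0 < r \<Longrightarrow> radial_profile (w1 \<beta> :: real^'n::finite \<Rightarrow> real) r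
     = ln (exp 1 / r) powr (\<beta> * real CARD('n) / 2)"
  using radial_profile_unit[where 'n='n] by (metis abs_of_pos mult.right_neutral norm_scaleR w1_def)

lemma c_const_pos:
  assumes "1 \<le> k" "k \<le> CARD('n::finite)"
  shows "c_const TYPE('n) k > 0"
proof -
  have "measure lborel (ball (0::real^'n) 1) > 0"
    by (rule content_ball_pos) simp
  then show ?thesis
    using assms by (simp add: c_const_def unit_sphere_area_def)
qed

text \<open>By n = 2k the factor r ^ (n - k) is r ^ k and the weight exponent \<beta> n / 2 is
  \<beta> k, so the energy is c_n times the integral of the preceding estimate. The power of 1 / c_n
  removes this factor.\<close>

lemma ftc_profile_le_Phi_norm:
  fixes u :: "real^'n::finite \<Rightarrow> real" and \<beta> :: real
  assumes k: "1 \<le> k" "CARD('n) = 2 * k" and \<beta>: "\<beta> > 1"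
    and u: "ftc_profile (radial_profile u)" and fin: "Phi_norm k (w1 \<beta>) u < \<infinity>"
    and r: "0 < r" "r < 1"
  shows "\<bar>radial_profile u r\<bar> \<le> (1 + 1 / (\<beta> - 1)) * (1 / c_const TYPE('n) k) powr (1 / real (k + 1))
           * enn2real (Phi_norm k (w1 \<beta>) u)"
proof -
  define c where "c = c_const TYPE('n) k"
  define B where "B = 1 + 1 / (\<beta> - 1)"
  have c: "c > 0" unfolding c_def using k by (intro c_const_pos) auto
  have B: "B > 0" using \<beta> by (simp add: B_def add_pos_pos)
  define I where "I = (\<integral>\<^sup>+r\<in>{0<..<1}. ennreal (r ^ k * \<bar>deriv (radial_profile u) r\<bar> ^ (k + 1)
      * ln (exp 1 / r) powr (\<beta> * real k)) \<partial>lebesgue)"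
  have en: "Phi_energy k (w1 \<beta>) u = ennreal c * I"
  proof -
    have "(\<integral>\<^sup>+ r\<in>{0<..<1}. ennreal (r ^ (CARD('n) - k) * \<bar>deriv (radial_profile u) r\<bar> ^ (k + 1)
        * radial_profile (w1 \<beta> :: real^'n \<Rightarrow> real) r) \<partial>lebesgue) = I"
      unfolding I_def
      by (intro nn_integral_cong) (auto simp: indicator_def radial_profile_w1 k(2))
    then show ?thesis by (simp add: Phi_energy_def c_def)
  qed
  have "Phi_energy k (w1 \<beta>) u \<noteq> \<infinity>"
    using fin by (auto simp: Phi_norm_def split: if_splits)
  then have "I \<noteq> \<infinity>" using c by (auto simp: en ennreal_mult_eq_top_iff)
  then obtain i where i: "i \<ge> 0" "I = ennreal i" by (cases I) auto
  define N where "N = enn2real (Phi_norm k (w1 \<beta>) u)"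
  have N: "N = (c * i) powr (1 / real (k + 1))"
    using c i by (simp add: N_def Phi_norm_def en ennreal_mult''[symmetric] ennreal_mult[symmetric])
  define m where "m = (1 / c) powr (1 / real (k + 1)) * N"
  have m: "m = i powr (1 / real (k + 1))"
    unfolding m_def N using c i(1) by (subst powr_mult[symmetric]) auto
  have "\<bar>radial_profile u r\<bar> \<le> B * m + e" if e: "e > 0" for e
  proof -
    \<comment> \<open>The estimate requires M > 0, but \<open>m\<close> vanishes with the energy.
      The slack e / B becomes \<open>e\<close> after multiplication by \<open>B\<close>.\<close>
    define M where "M = m + e / B"
    have M: "M > m" "m \<ge> 0" "M > 0" using e B m by (auto simp: M_def add_nonneg_pos)
    have "i = m ^ (k + 1)"
    proof (cases "i = 0")
      case False
      then show ?thesis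
        unfolding m using i(1) by (subst powr_realpow[symmetric]) (auto simp: powr_powr)
    qed (simp add: m)
    also have "\<dots> \<le> M ^ (k + 1)" using M by (intro power_mono) auto
    finally have "I \<le> ennreal (M ^ (k + 1))" by (simp add: i(2) ennreal_leI)
    then have "\<bar>radial_profile u r\<bar> \<le> M * B"
      unfolding I_def B_def by (intro ftc_profile_le_weighted_energy[OF \<beta> M(3) u r])
    also have "\<dots> = B * m + e" using B by (simp add: M_def field_simps)
    finally show ?thesis .
  qed
  then have "\<bar>radial_profile u r\<bar> \<le> B * m" by (rule field_le_epsilon)
  then show ?thesis by (simp add: m_def B_def N_def c_def mult.assoc)
qed

text \<open>Measurability has to be proved, since otherwise the essential supremum is infinite. The
  profile gives continuity away from the origin, a null set where the value of \<open>u\<close> is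
  arbitrary.\<close>

lemma Linf_norm_le_profile_bound:
  fixes u :: "real^'n::finite \<Rightarrow> real"
  assumes rad: "radial_on (ball 0 1) u" and cont: "continuous_on {0<..<1} (radial_profile u)"
    and le: "\<And>r. 0 < r \<Longrightarrow> r < 1 \<Longrightarrow> \<bar>radial_profile u r\<bar> \<le> C"
  shows "Linf_norm u \<le> ennreal C"
proof -
  have eq: "radial_profile u (norm x) = u x" if "x \<in> ball 0 1" for x
    by (rule radial_profile_norm[OF rad that]) (use that in auto)
  have "continuous_on (ball 0 1 - {0}) (\<lambda>x. radial_profile u (norm x))"
    by (intro continuous_on_compose2[OF cont] continuous_intros) auto
  then have "continuous_on (ball 0 1 - {0}) u"
    by (rule continuous_on_eq) (use eq in auto)
  then have "u \<in> borel_measurable (lebesgue_on (ball 0 1 - {0}))"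
    by (intro continuous_imp_measurable_on_sets_lebesgue) auto
  then have w: "(\<lambda>x. if x \<in> ball 0 1 - {0} then u x else 0) \<in> borel_measurable lebesgue"
    by (subst borel_measurable_if) auto
  \<comment> \<open>Restoring the value at the origin changes the function on a single
    point.\<close>
  have "(\<lambda>x. if x \<in> {0} then u 0 else if x \<in> ball 0 1 - {0} then u x else 0)
      \<in> borel_measurable lebesgue"
    by (rule measurable_If_set[OF _ w]) auto
  then have "(\<lambda>x. if x \<in> {0} then u 0 else if x \<in> ball 0 1 - {0} then u x else 0)
      \<in> borel_measurable (lebesgue_on (ball 0 1))"
    by (rule measurable_restrict_space1)
  then have um: "u \<in> borel_measurable (lebesgue_on (ball 0 1))"
    by (rule measurable_cong[THEN iffD1, rotated]) (auto simp: space_restrict_space)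
  have "AE x in lebesgue. (x::real^'n) \<noteq> 0"
    by (intro AE_completion AE_lborel_singleton)
  then have "AE x in lebesgue_on (ball 0 1). (x::real^'n) \<noteq> 0"
    by (subst AE_restrict_space_iff) auto
  then have "AE x in lebesgue_on (ball 0 1). ennreal \<bar>u x\<bar> \<le> ennreal C"
  proof (rule AE_mp[OF _ AE_I2], intro impI)
    fix x :: "real^'n" assume "x \<in> space (lebesgue_on (ball 0 1))" "x \<noteq> 0"
    then have "x \<in> ball 0 1" "0 < norm x" "norm x < 1" by (auto simp: space_restrict_space)
    then show "ennreal \<bar>u x\<bar> \<le> ennreal C"
      using le[of "norm x"] eq[of x] by (simp add: ennreal_leI)
  qed
  then show ?thesis
    unfolding Linf_norm_def using um by (intro esssup_I) auto
qed

section \<open>Profiles of admissible functions and of elements of the closure\<close>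

lemma locally_absolutely_continuous_has_integral_deriv:
  assumes v: "locally_absolutely_continuous v" and ab: "0 < a" "a \<le> b" "b < 1"
  shows "(deriv v has_integral v b - v a) {a..b}"
proof (cases "a = b")
  case False
  then show ?thesis
    using v ab by (intro absolutely_continuous_has_integral_deriv)
      (auto simp: locally_absolutely_continuous_def)
qed (use has_integral_refl[of "deriv v" b] in simp)

lemma continuous_on_if_has_integral_deriv:
  fixes v :: "real \<Rightarrow> real"
  assumes v: "\<And>a b. 0 < a \<Longrightarrow> a \<le> b \<Longrightarrow> b < 1 \<Longrightarrow> (deriv v has_integral v b - v a) {a..b}"
  shows "continuous_on {0<..<1} v"
proof -
  have "continuous (at x) v" if x: "x \<in> {0<..<1}" for x
  proof -
    define a b where "a = x / 2" and "b = (x + 1) / 2"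
    have ab: "0 < a" "a < x" "x < b" "b < 1" using x by (auto simp: a_def b_def)
    have "continuous_on {a..b} (\<lambda>y. v a + integral {a..y} (deriv v))"
      using v[of a b] ab by (intro continuous_intros indefinite_integral_continuous_1) auto
    then have "continuous_on {a..b} v"
    proof (rule continuous_on_eq)
      fix y assume "y \<in> {a..b}"
      then show "v a + integral {a..y} (deriv v) = v y"
        using integral_unique[OF v[of a y]] ab by simp
    qed
    then have "continuous_on {a<..<b} v" by (rule continuous_on_subset) auto
    then show ?thesis using ab by (simp add: continuous_on_eq_continuous_at)
  qed
  then show ?thesis by (simp add: continuous_at_imp_continuous_on)
qed

text \<open>Along the ray through a unit vector, the limit comes from continuity on the closed ball,
  differentiability from the chain rule, and the bound from compactness.\<close>

lemma admissible_profile: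
  fixes u :: "real^'n::finite \<Rightarrow> real"
  assumes u: "u \<in> Phi0_rad k"
  shows "(radial_profile u \<longlongrightarrow> 0) (at_left 1)"
    and "0 < r \<Longrightarrow> r < 1 \<Longrightarrow> radial_profile u differentiable (at r)"
    and "\<exists>K. \<forall>r. 0 < r \<and> r < 1 \<longrightarrow> \<bar>radial_profile u r\<bar> \<le> K"
proof -
  obtain e :: "real^'n" where e: "norm e = 1" and p: "\<And>u r. radial_profile u r = u (r *\<^sub>R e)"
    using radial_profile_unit[where 'n='n] by metis
  have C: "u differentiable_on ball 0 1" "continuous_on (cball 0 1) u" "\<And>x. norm x = 1 \<Longrightarrow> u x = 0"
    using u by (auto simp: Phi0_rad_def k_admissible_def C2_on_def)
  have "continuous_on {0..1} (\<lambda>r. u (r *\<^sub>R e))"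
    by (intro continuous_on_compose2[OF C(2)] continuous_intros) (auto simp: e)
  then have "((\<lambda>r. u (r *\<^sub>R e)) \<longlongrightarrow> u (1 *\<^sub>R e)) (at 1 within {0..1})"
    unfolding continuous_on by (rule bspec) simp
  then have "((\<lambda>r. u (r *\<^sub>R e)) \<longlongrightarrow> 0) (at 1 within {0..1})"
    using C(3) e by simp
  then show "(radial_profile u \<longlongrightarrow> 0) (at_left 1)"
    by (simp add: at_within_Icc_at_left p[abs_def])
  show "radial_profile u differentiable (at r)" if "0 < r" "r < 1"
  proof -
    have "r *\<^sub>R e \<in> ball 0 1" using that e by simp
    then have "u differentiable (at (r *\<^sub>R e))"
      using C(1) by (simp add: differentiable_on_eq_differentiable_at)
    then have "(u \<circ> (\<lambda>r. r *\<^sub>R e)) differentiable (at r)"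
      by (intro differentiable_chain_at) auto
    then show ?thesis by (simp add: o_def p[abs_def])
  qed
  have "bounded (u ` cball 0 1)"
    by (intro compact_imp_bounded compact_continuous_image C(2)) auto
  then obtain K where "\<And>x. x \<in> cball 0 1 \<Longrightarrow> \<bar>u x\<bar> \<le> K"
    unfolding bounded_iff by (metis imageI real_norm_def)
  then show "\<exists>K. \<forall>r. 0 < r \<and> r < 1 \<longrightarrow> \<bar>radial_profile u r\<bar> \<le> K"
    by (auto simp: p e intro!: exI[of _ K])
qed

text \<open>The derivative of the difference is the difference of the derivatives where both
  profiles are differentiable: everywhere in (0, 1) for \<open>U\<close>, off a null set for
  \<open>u\<close>. The integral does not see that set.\<close>

lemma ftc_profile_admissible_diff:
  fixes u U :: "real^'n::finite \<Rightarrow> real"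
  assumes U: "U \<in> Phi0_rad k" and v: "locally_absolutely_continuous (radial_profile u)"
    "(radial_profile u \<longlongrightarrow> 0) (at_left 1)"
  shows "ftc_profile (radial_profile (\<lambda>x. U x - u x))"
proof -
  let ?p = "radial_profile U" and ?v = "radial_profile u"
  let ?d = "radial_profile (\<lambda>x. U x - u x)"
  have d: "?d = (\<lambda>r. ?p r - ?v r)" by (simp add: radial_profile_def fun_eq_iff)
  show ?thesis
    unfolding ftc_profile_def
  proof (intro conjI allI impI)
    show "(?d \<longlongrightarrow> 0) (at_left 1)"
      using tendsto_diff[OF admissible_profile(1)[OF U] v(2)] by (simp add: d)
    fix a b :: real assume ab: "0 < a \<and> a \<le> b \<and> b < 1"
    have p: "(?p has_real_derivative deriv ?p r) (at r)" if "r \<in> {a..b}" for r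
      using admissible_profile(2)[OF U, of r] that ab
      by (auto simp: real_differentiable_def dest: DERIV_imp_deriv)
    have "(deriv ?p has_integral ?p b - ?p a) {a..b}"
      using ab p by (intro fundamental_theorem_of_calculus)
        (auto simp: has_real_derivative_iff_has_vector_derivative[symmetric]
            intro: has_field_derivative_at_within)
    moreover have "(deriv ?v has_integral ?v b - ?v a) {a..b}"
      using ab by (intro locally_absolutely_continuous_has_integral_deriv[OF v(1)]) auto
    ultimately have hi: "((\<lambda>r. deriv ?p r - deriv ?v r) has_integral (?p b - ?p a) - (?v b - ?v a)) {a..b}"
      by (rule has_integral_diff)
    \<comment> \<open>Differentiability almost everywhere is stated for the open interval, so the
      endpoints join the exceptional set.\<close>
    define N where "N = {r\<in>{a<..<b}. \<not> ?v differentiable (at r)} \<union> {a, b}"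
    have "negligible {r\<in>{a<..<b}. \<not> ?v differentiable (at r)}"
    proof (cases "a = b")
      case False
      then show ?thesis using v(1) ab
        by (intro absolutely_continuous_imp_differentiable_ae) (auto simp: locally_absolutely_continuous_def)
    qed simp
    then have N: "negligible N" by (auto simp: N_def)
    have "deriv ?d r = deriv ?p r - deriv ?v r" if "r \<in> {a..b} - N" for r
    proof -
      have "?v differentiable (at r)" using that by (auto simp: N_def)
      then have "(?v has_real_derivative deriv ?v r) (at r)"
        by (auto simp: real_differentiable_def dest: DERIV_imp_deriv)
      with p[of r] that show ?thesis
        unfolding d by (intro DERIV_imp_deriv DERIV_diff) auto
    qed
    from has_integral_spike[OF N this hi]
    show "(deriv ?d has_integral ?d b - ?d a) {a..b}"
      by (simp add: d algebra_simps)
  qed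
qed

theorem theorem1p2:
  fixes \<beta> :: real and k :: nat
  assumes "CARD('n::finite) \<ge> 2" and "even CARD('n)"
    and "k = CARD('n) div 2" and "\<beta> > 1"
  shows "\<exists>C>0. \<forall>u\<in>Phi0_rad_weighted k (w1 \<beta> :: real^'n \<Rightarrow> real).
           Linf_norm u < \<infinity> \<and> Linf_norm u \<le> ennreal C * Phi_norm k (w1 \<beta>) u"
proof -
  have k: "1 \<le> k" "CARD('n) = 2 * k" using assms(1-3) by auto
  define C where "C = (1 + 1 / (\<beta> - 1)) * (1 / c_const TYPE('n) k) powr (1 / real (k + 1))"
  have "c_const TYPE('n) k > 0" using k by (intro c_const_pos) auto
  then have C: "C > 0"
    using \<open>\<beta> > 1\<close> by (auto simp: C_def intro!: mult_pos_pos add_pos_pos)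
  have "Linf_norm u < \<infinity> \<and> Linf_norm u \<le> ennreal C * Phi_norm k (w1 \<beta>) u"
    if u: "u \<in> Phi0_rad_weighted k (w1 \<beta> :: real^'n \<Rightarrow> real)" for u
  proof
    let ?v = "radial_profile u"
    from u obtain U where rad: "radial_on (ball 0 1) u"
      and v: "locally_absolutely_continuous ?v" "(?v \<longlongrightarrow> 0) (at_left 1)"
      and U: "\<And>m. U m \<in> Phi0_rad k" "(\<lambda>m. Phi_norm k (w1 \<beta>) (\<lambda>x. U m x - u x)) \<longlonglongrightarrow> 0"
      unfolding Phi0_rad_weighted_def by blast
    have ftc: "ftc_profile ?v"
      using locally_absolutely_continuous_has_integral_deriv[OF v(1)] v(2) by (auto simp: ftc_profile_def)
    have cont: "continuous_on {0<..<1} ?v"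
      by (intro continuous_on_if_has_integral_deriv locally_absolutely_continuous_has_integral_deriv[OF v(1)])
    have "\<forall>\<^sub>F m in sequentially. Phi_norm k (w1 \<beta>) (\<lambda>x. U m x - u x) < \<infinity>"
      using order_tendstoD(2)[OF U(2), of \<infinity>] by simp
    \<comment> \<open>finiteness of the essential supremum: \<open>u\<close> differs from the bounded function \<open>U m\<close> by a function
      of finite norm\<close>
    then obtain m where m: "Phi_norm k (w1 \<beta>) (\<lambda>x. U m x - u x) < \<infinity>"
      by (auto simp: eventually_sequentially)
    obtain K where K: "\<forall>r. 0 < r \<and> r < 1 \<longrightarrow> \<bar>radial_profile (U m) r\<bar> \<le> K"
      using admissible_profile(3)[OF U(1)] by blast
    define D where "D = C * enn2real (Phi_norm k (w1 \<beta>) (\<lambda>x. U m x - u x))"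
    have "\<bar>?v r\<bar> \<le> K + D" if r: "0 < r" "r < 1" for r
    proof -
      have "\<bar>radial_profile (\<lambda>x. U m x - u x) r\<bar> \<le> D"
        unfolding D_def C_def
        by (intro ftc_profile_le_Phi_norm k assms(4) m r ftc_profile_admissible_diff[OF U(1) v])
      moreover have "radial_profile (\<lambda>x. U m x - u x) r = radial_profile (U m) r - ?v r"
        by (simp add: radial_profile_def)
      moreover have "\<bar>radial_profile (U m) r\<bar> \<le> K" using K r by blast
      ultimately show ?thesis by linarith
    qed
    then have "Linf_norm u \<le> ennreal (K + D)"
      by (rule Linf_norm_le_profile_bound[OF rad cont])
    then show "Linf_norm u < \<infinity>" by (simp add: le_less_trans)
    show "Linf_norm u \<le> ennreal C * Phi_norm k (w1 \<beta>) u"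
    proof (cases "Phi_norm k (w1 \<beta>) u < \<infinity>")
      case True
      have "\<bar>?v r\<bar> \<le> C * enn2real (Phi_norm k (w1 \<beta>) u)" if "0 < r" "r < 1" for r
        unfolding C_def using that by (intro ftc_profile_le_Phi_norm k assms(4) True ftc)
      then have "Linf_norm u \<le> ennreal (C * enn2real (Phi_norm k (w1 \<beta>) u))"
        by (rule Linf_norm_le_profile_bound[OF rad cont])
      also have "\<dots> = ennreal C * Phi_norm k (w1 \<beta>) u"
        using True C by (simp add: ennreal_mult)
      finally show ?thesis .
    next
      case False
      then have "Phi_norm k (w1 \<beta>) u = \<infinity>" by (simp add: not_less top_unique)
      then show ?thesis using C by (simp add: ennreal_mult_top)
    qed
  qed
  then show ?thesis using C by blast
qed

end
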